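(* Let $d\le n$, let $M\in\mathbb{Z}^{d\times(n-d)}$, and let $A=(M\ I_d)\in\mathbb{Z}^{d\times n}$ with columns $\mathbf{a}_1,\dots,\mathbf{a}_n$, where $N=\{1,\dots,n-d\}$ indexes the columns of $M$ and $B=\{n-d+1,\dots,n\}$ indexes the columns of $I_d$. Assume $A$ is unimodular (all nonzero maximal minors have the same absolute value). Let $\tilde{\mathbf{c}}\in\mathbb{R}^n$ be generic, let $\tilde{\mathbf{b}}\in\mathbb{Z}^n$ with $\tilde{\mathbf{b}}_N=\mathbf{0}$, and let $H=(I_{n-d}\ \ -M^{\mathrm T})\in\mathbb{Z}^{(n-d)\times n}$ with columns indexed by $[n]$ in the same order. Let $(1,\sigma)$ be a standard pair of $in_{\tilde{\mathbf{c}}}(I_A)$ and $\bar\sigma=[n]\setminus\sigma$. Then the solution $(x_i)_{i\in\sigma}$ of the linear system $\sum_{i\in\sigma}x_i\mathbf{a}_i=\tilde{\mathbf{b}}_B$ is the reduced cost $\tilde{\mathbf{b}}'_\sigma=\tilde{\mathbf{b}}_\sigma-H_\sigma^{\mathrm T}(H_{\bar\sigma}^{-1})^{\mathrm T}\tilde{\mathbf{b}}_{\bar\sigma}$ of the dual problem $\min\{\tilde{\mathbf{b}}_B^{\mathrm T}\mathbf{y}'':\ I_{n-d}\mathbf{y}'-M^{\mathrm T}\mathbf{y}''=\tilde{\mathbf{c}},\ \mathbf{y}',\mathbf{y}''\ge\mathbf{0}\}$ for the basis $\bar\sigma$.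
   Context: For a matrix $H$ and index set $\tau$, $H_\tau$ is the submatrix of columns indexed by $\tau$, and $\tilde{\mathbf{b}}_\tau=(\tilde b_i)_{i\in\tau}$. The toric ideal is $I_A=\langle\mathbf{x}^{\mathbf{u}}-\mathbf{x}^{\mathbf{v}}:A\mathbf{u}=A\mathbf{v},\ \mathbf{u},\mathbf{v}\in\mathbb{N}^n\rangle\subseteq k[x_1,\dots,x_n]$. $\tilde{\mathbf{c}}$ is generic if every program $\min\{\tilde{\mathbf{c}}\cdot\mathbf{x}:A\mathbf{x}=A\mathbf{u},\ \mathbf{x}\in\mathbb{N}^n\}$, $\mathbf{u}\in\mathbb{N}^n$, has a unique optimum; $in_{\tilde{\mathbf{c}}}(I_A)$ is the (monomial) ideal generated by the $\tilde{\mathbf{c}}$-largest terms of elements of $I_A$. A standard pair of a monomial ideal $J$ is $(\mathbf{x}^{\mathbf{a}},\sigma)$, $\sigma\subseteq[n]$, with (i) $\mathrm{supp}(\mathbf{a})\cap\sigma=\emptyset$; (ii) no monomial $\mathbf{x}^{\mathbf{a}}\mathbf{x}^{\mathbf{w}}$ with $\mathrm{supp}(\mathbf{w})\subseteq\sigma$ lies in $J$; (iii) no other pair $(\mathbf{x}^{\mathbf{a}'},\sigma')$ satisfying (i),(ii) has $\mathbf{x}^{\mathbf{a}'}\mid\mathbf{x}^{\mathbf{a}}$ and $\mathrm{supp}(\mathbf{x}^{\mathbf{a}}/\mathbf{x}^{\mathbf{a}'})\cup\sigma\subseteq\sigma'$.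
   Formalization: The dual constraint has n-d rows, so its right-hand side cannot be c in R^n as written; the formal theorem allows an arbitrary right-hand side r in R^(n-d), which covers both c_N and Hc; reduced costs do not depend on it. *)

theory Defs
  imports
    Complex_Main
    "HOL-Library.Poly_Mapping"
    "HOL-Algebra.Ideal"
    "Jordan_Normal_Form.DL_Submatrix"
    "Jordan_Normal_Form.Determinant"
    "Jordan_Normal_Form.Gauss_Jordan_Elimination"
begin

text \<open>
  All index sets are zero-based: \<open>[n]\<close> is \<open>{..<n}\<close>, and for \<open>A = (M I)\<close> with \<open>d\<close> rows and \<open>n\<close>
  columns, \<open>N\<close> is \<open>{..<n - d}\<close> and \<open>B\<close> is \<open>{n - d..<n}\<close>. Submatrices and subvectors list the
  selected indices in increasing order.
\<close>

definition cols_at :: "'a mat \<Rightarrow> nat set \<Rightarrow> 'a mat" where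
  "cols_at H \<tau> = submatrix H UNIV \<tau>"

definition subvec :: "'a vec \<Rightarrow> nat set \<Rightarrow> 'a vec" where
  "subvec v \<tau> = vec (card {i. i < dim_vec v \<and> i \<in> \<tau>}) (\<lambda>i. v $ pick \<tau> i)"

definition hcat :: "'a::zero mat \<Rightarrow> 'a mat \<Rightarrow> 'a mat" where
  "hcat P Q = mat (dim_row P) (dim_col P + dim_col Q)
     (\<lambda>(i, j). if j < dim_col P then P $$ (i, j) else Q $$ (i, j - dim_col P))"

definition primal_mat :: "int mat \<Rightarrow> int mat" where
  "primal_mat M = hcat M (1\<^sub>m (dim_row M))"

definition dual_mat :: "int mat \<Rightarrow> int mat" where
  "dual_mat M = hcat (1\<^sub>m (dim_col M)) (- transpose_mat M)"

definition unimodular :: "int mat \<Rightarrow> bool" where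
  "unimodular A \<longleftrightarrow>
     (\<forall>I J. I \<subseteq> {..<dim_col A} \<and> card I = dim_row A \<and> det (cols_at A I) \<noteq> 0 \<and>
            J \<subseteq> {..<dim_col A} \<and> card J = dim_row A \<and> det (cols_at A J) \<noteq> 0
        \<longrightarrow> \<bar>det (cols_at A I)\<bar> = \<bar>det (cols_at A J)\<bar>)"


subsection \<open>Polynomials in \<open>n\<close> variables and toric ideals\<close>

text \<open>
  Exponent vectors in \<open>\<nat>\<^sup>n\<close> are finitely supported functions on \<open>nat\<close> vanishing outside \<open>{..<n}\<close>;
  \<open>k[x\<^sub>0, \<dots>, x\<^bsub>n-1\<^esub>]\<close> consists of the polynomials all of whose exponents are of this kind.
\<close>

type_synonym expo = "nat \<Rightarrow>\<^sub>0 nat"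
type_synonym 'k mpoly = "expo \<Rightarrow>\<^sub>0 'k"

definition expos :: "nat \<Rightarrow> expo set" where
  "expos n = {u. Poly_Mapping.keys u \<subseteq> {..<n}}"

definition expo_vec :: "nat \<Rightarrow> expo \<Rightarrow> 'a::semiring_1 vec" where
  "expo_vec n u = vec n (\<lambda>i. of_nat (Poly_Mapping.lookup u i))"

abbreviation monomial :: "expo \<Rightarrow> 'k::field mpoly" where
  "monomial u \<equiv> Poly_Mapping.single u 1"

definition mpoly_ring :: "nat \<Rightarrow> 'k::field mpoly ring" where
  "mpoly_ring n =
     \<lparr>carrier = {p. Poly_Mapping.keys p \<subseteq> expos n}, monoid.mult = (*), one = 1, zero = 0, add = (+)\<rparr>"

lemma cring_mpoly_ring: "cring (mpoly_ring n :: 'k::field mpoly ring)"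
proof (rule cringI)
  have neg: "- p \<in> carrier (mpoly_ring n)"
    if "p \<in> carrier (mpoly_ring n)" for p :: "'k mpoly"
    using that by (auto simp: mpoly_ring_def in_keys_iff subset_iff)
  show "abelian_group (mpoly_ring n :: 'k mpoly ring)"
  proof (rule abelian_groupI)
    fix p q :: "'k mpoly"
    assume "p \<in> carrier (mpoly_ring n)" "q \<in> carrier (mpoly_ring n)"
    then show "p \<oplus>\<^bsub>mpoly_ring n\<^esub> q \<in> carrier (mpoly_ring n)"
      using keys_add[of p q] by (auto simp: mpoly_ring_def)
  next
    fix p :: "'k mpoly"
    assume "p \<in> carrier (mpoly_ring n)"
    then show "\<exists>q\<in>carrier (mpoly_ring n). q \<oplus>\<^bsub>mpoly_ring n\<^esub> p = \<zero>\<^bsub>mpoly_ring n\<^esub>"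
      using neg by (intro bexI[of _ "- p"]) (auto simp: mpoly_ring_def)
  qed (auto simp: mpoly_ring_def algebra_simps)
  show "comm_monoid (mpoly_ring n :: 'k mpoly ring)"
  proof (rule comm_monoidI)
    fix p q :: "'k mpoly"
    assume pq: "p \<in> carrier (mpoly_ring n)" "q \<in> carrier (mpoly_ring n)"
    have "Poly_Mapping.keys (u + v) \<subseteq> {..<n}" if "u \<in> Poly_Mapping.keys p" "v \<in> Poly_Mapping.keys q" for u v
      using that pq keys_add[of u v] by (fastforce simp: mpoly_ring_def expos_def)
    then show "p \<otimes>\<^bsub>mpoly_ring n\<^esub> q \<in> carrier (mpoly_ring n)"
      using keys_mult[of p q] by (fastforce simp: mpoly_ring_def expos_def)
  qed (auto simp: mpoly_ring_def expos_def algebra_simps)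
qed (auto simp: mpoly_ring_def algebra_simps)

definition toric_ideal :: "int mat \<Rightarrow> 'k::field mpoly set" where
  "toric_ideal A = (let n = dim_col A in
     Idl\<^bsub>mpoly_ring n\<^esub>
       {monomial u - monomial v | u v. u \<in> expos n \<and> v \<in> expos n \<and>
          A *\<^sub>v expo_vec n u = A *\<^sub>v expo_vec n v})"

definition weight :: "real vec \<Rightarrow> expo \<Rightarrow> real" where
  "weight c u = c \<bullet> expo_vec (dim_vec c) u"

text \<open>The sum of the terms of \<open>f\<close> of largest \<open>c\<close>-weight; it is \<open>0\<close> for \<open>f = 0\<close>.\<close>

definition initial_form :: "real vec \<Rightarrow> 'k::field mpoly \<Rightarrow> 'k mpoly" where
  "initial_form c f =
     (\<Sum>u \<in> {u \<in> Poly_Mapping.keys f. \<forall>v \<in> Poly_Mapping.keys f. weight c v \<le> weight c u}. Poly_Mapping.single u (Poly_Mapping.lookup f u))"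

definition initial_ideal :: "real vec \<Rightarrow> 'k::field mpoly set \<Rightarrow> 'k mpoly set" where
  "initial_ideal c I = Idl\<^bsub>mpoly_ring (dim_vec c)\<^esub> (initial_form c ` I)"

definition feasible :: "int mat \<Rightarrow> expo \<Rightarrow> expo set" where
  "feasible A u = (let n = dim_col A in
     {x \<in> expos n. A *\<^sub>v expo_vec n x = A *\<^sub>v expo_vec n u})"

definition generic_cost :: "int mat \<Rightarrow> real vec \<Rightarrow> bool" where
  "generic_cost A c \<longleftrightarrow>
     (\<forall>u \<in> expos (dim_col A).
        \<exists>!x. x \<in> feasible A u \<and> (\<forall>y \<in> feasible A u. weight c x \<le> weight c y))"


subsection \<open>Standard pairs\<close>

definition admissible_pair :: "nat \<Rightarrow> 'k::field mpoly set \<Rightarrow> expo \<Rightarrow> nat set \<Rightarrow> bool" where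
  "admissible_pair n J a \<sigma> \<longleftrightarrow>
     a \<in> expos n \<and> \<sigma> \<subseteq> {..<n} \<and> Poly_Mapping.keys a \<inter> \<sigma> = {} \<and>
     (\<forall>w. Poly_Mapping.keys w \<subseteq> \<sigma> \<longrightarrow> monomial a * monomial w \<notin> J)"

text \<open>
  In the maximality clause, \<open>x\<^sup>w\<close> is the quotient of \<open>x\<^sup>a\<close> by \<open>x\<^bsup>a'\<^esup>\<close>.
\<close>

definition standard_pair :: "nat \<Rightarrow> 'k::field mpoly set \<Rightarrow> expo \<Rightarrow> nat set \<Rightarrow> bool" where
  "standard_pair n J a \<sigma> \<longleftrightarrow>
     admissible_pair n J a \<sigma> \<and>
     (\<forall>a' \<sigma>'. admissible_pair n J a' \<sigma>' \<and> (\<exists>w. a = a' + w \<and> Poly_Mapping.keys w \<union> \<sigma> \<subseteq> \<sigma>')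
        \<longrightarrow> (a', \<sigma>') = (a, \<sigma>))"


subsection \<open>Linear programs in standard form\<close>

text \<open>
  The record stands for the program of minimising \<open>lp_cost \<bullet> y\<close> subject to
  \<open>lp_mat *\<^sub>v y = lp_rhs\<close>, \<open>y \<ge> 0\<close>.
\<close>

record std_lp =
  lp_mat :: "real mat"
  lp_rhs :: "real vec"
  lp_cost :: "real vec"

definition lp_basis :: "std_lp \<Rightarrow> nat set \<Rightarrow> bool" where
  "lp_basis P \<beta> \<longleftrightarrow>
     \<beta> \<subseteq> {..<dim_col (lp_mat P)} \<and> invertible_mat (cols_at (lp_mat P) \<beta>)"

text \<open>
  The vector \<open>cost\<^sub>\<nu> - D\<^sub>\<nu>\<^sup>T (D\<^sub>\<beta>\<^sup>-\<^sup>1)\<^sup>T cost\<^sub>\<beta>\<close> of reduced costs of the nonbasic variables \<open>\<nu>\<close>,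
  where \<open>D\<close> is the constraint matrix; meaningful only if \<open>\<beta>\<close> is a basis.
\<close>

definition reduced_costs :: "std_lp \<Rightarrow> nat set \<Rightarrow> real vec" where
  "reduced_costs P \<beta> =
     (let D = lp_mat P; \<nu> = {..<dim_col D} - \<beta> in
      subvec (lp_cost P) \<nu> -
      transpose_mat (cols_at D \<nu>) *\<^sub>v
        (transpose_mat (the (mat_inverse (cols_at D \<beta>))) *\<^sub>v subvec (lp_cost P) \<beta>))"

text \<open>
  The program of minimising \<open>b\<^sub>B\<^sup>T y''\<close> subject to \<open>I y' - M\<^sup>T y'' = r\<close>, \<open>y', y'' \<ge> 0\<close>, in the
  variables \<open>y = (y', y'')\<close>, where \<open>b\<^sub>B\<close> has one entry for each row of \<open>M\<close>.  For a cost vector \<open>c\<close>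
  with \<open>c\<^sub>B = 0\<close>, the right-hand side \<open>r = c\<^sub>N\<close> makes this the dual of minimising \<open>c \<bullet> x\<close> subject to
  \<open>(M I) x = b\<^sub>B\<close>, \<open>x \<ge> 0\<close>; for general \<open>c\<close> it is \<open>r = (I -M\<^sup>T) c\<close>.  Bases and reduced costs do
  not depend on \<open>r\<close>.
\<close>

definition dual_program :: "int mat \<Rightarrow> int vec \<Rightarrow> real vec \<Rightarrow> std_lp" where
  "dual_program M b\<^sub>B r =
     \<lparr>lp_mat = map_mat real_of_int (dual_mat M), lp_rhs = r,
      lp_cost = 0\<^sub>v (dim_col M) @\<^sub>v map_vec real_of_int b\<^sub>B\<rparr>"

end

theory Submission
  imports Defs
begin

text \<open>
  A monomial lies in the initial ideal iff its exponent is not optimal for the integer program of its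
  fiber: the coefficients of an element of the toric ideal add up to zero on every fiber, and an
  optimal exponent is the only exponent of least weight in its fiber.  Hence \<open>(1, \<sigma>)\<close> is a standard
  pair iff \<open>\<sigma>\<close> is maximal among the sets all of whose exponents are optimal.  Eliminating variables
  from \<open>y A \<le> c\<close>, with equality on \<open>\<sigma>\<close>, shows that optimality on \<open>\<sigma>\<close> is witnessed by some \<open>y\<close>.
  Uniqueness of optima makes the columns of \<open>A\<close> in \<open>\<sigma>\<close> independent; were there fewer than \<open>d\<close> of
  them, \<open>y\<close> could be moved along a direction orthogonal to them until another inequality becomes tight,
  against maximality.  So \<open>A\<^bsub>\<sigma>\<^esub>\<close> is invertible, and \<open>A H\<^sup>T = 0\<close>, that is
  \<open>A\<^bsub>\<sigma>\<^esub> H\<^bsub>\<sigma>\<^esub>\<^sup>T = - A\<^bsub>\<tau>\<^esub> H\<^bsub>\<tau>\<^esub>\<^sup>T\<close> for the complement \<open>\<tau>\<close> of \<open>\<sigma>\<close>, transfers this to \<open>H\<^bsub>\<tau>\<^esub>\<close> and gives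
  the formula for the solution.
\<close>

subsection \<open>Linear inequalities\<close>

text \<open>This supplies a value for the eliminated variable once every lower bound on it is known
  to lie below every upper bound; one of the two sets of bounds may be empty.\<close>

lemma finite_sets_separation:
  fixes L U :: "real set"
  assumes "finite L" "finite U" "\<And>l u. l \<in> L \<Longrightarrow> u \<in> U \<Longrightarrow> l \<le> u"
  shows "\<exists>t. (\<forall>l\<in>L. l \<le> t) \<and> (\<forall>u\<in>U. t \<le> u)"
proof (cases "L = {}")
  case True
  show ?thesis
  proof (cases "U = {}")
    case False
    then show ?thesis
      using True assms by (intro exI[of _ "Min U"]) auto
  qed (use True in auto)
next
  case False
  then show ?thesis
    using assms by (intro exI[of _ "Max L"]) auto
qed

text \<open>
  \<open>C\<close> stands for any set of consequences of the system \<open>S\<close> that contains the positive integer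
  combinations used in eliminating a variable.
\<close>

lemma fourier_motzkin:
  fixes S :: "((nat \<Rightarrow> int) \<times> real) set" and C :: "(nat \<Rightarrow> int) \<Rightarrow> real \<Rightarrow> bool"
  assumes add: "\<And>a s a' s'. C a s \<Longrightarrow> C a' s' \<Longrightarrow> C (\<lambda>i. a i + a' i) (s + s')"
    and nonneg: "\<And>s. C (\<lambda>i. 0) s \<Longrightarrow> 0 \<le> s"
    and "finite S" "\<And>a s. (a, s) \<in> S \<Longrightarrow> C a s"
    and "\<And>a s i. (a, s) \<in> S \<Longrightarrow> d \<le> i \<Longrightarrow> a i = 0"
  shows "\<exists>y. \<forall>(a, s)\<in>S. (\<Sum>i<d. y i * real_of_int (a i)) \<le> s"
  using assms(3-)
proof (induction d arbitrary: S)
  case 0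
  have "0 \<le> s" if "(a, s) \<in> S" for a s
  proof -
    have "a = (\<lambda>i. 0)"
      using 0(3)[OF that] by auto
    then show ?thesis
      using nonneg 0(2)[OF that] by simp
  qed
  then show ?case by auto
next
  case (Suc d)
  \<comment> \<open>\<open>C\<close> is only known to be closed under sums, so multiples arise by
    repeated addition. The factor has the form \<open>Suc k\<close> because the zero combination
    need not belong to \<open>C\<close>.\<close>
  have scale: "C (\<lambda>i. int (Suc k) * a i) (real (Suc k) * s)" if "C a s" for a s k
  proof (induction k)
    case 0
    then show ?case using that by simp
  next
    case (Suc k)
    from add[OF this that] show ?case
      by (simp add: algebra_simps)
  qed
  have scale': "C (\<lambda>i. m * a i) (real_of_int m * s)" if "C a s" "0 < m" for a s m
    using scale[OF that(1), of "nat (m - 1)"] that(2) by (simp add: algebra_simps)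
  \<comment> \<open>Adding \<open>fst p d\<close> times \<open>q\<close> and
    \<open>- fst q d\<close> times \<open>p\<close> cancels the coefficient of variable
    \<open>d\<close>; both factors are positive for \<open>p\<close> in \<open>P\<close> and
    \<open>q\<close> in \<open>Q\<close>.\<close>
  define comb where "comb = (\<lambda>(p, q). (\<lambda>i. (fst p :: nat \<Rightarrow> int) d * fst q i + (- fst q d) * fst p i,
      real_of_int (fst p d) * snd q + real_of_int (- fst q d) * snd p))"
  define P where "P = {x \<in> S. 0 < fst x d}"
  define Q where "Q = {x \<in> S. fst x d < 0}"
  define Z where "Z = {x \<in> S. fst x d = 0}"
  define S' where "S' = Z \<union> comb ` (P \<times> Q)"
  have fin: "finite P" "finite Q" "finite Z"
    using Suc.prems(1) by (auto simp: P_def Q_def Z_def)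
  have "\<exists>y. \<forall>(a, s)\<in>S'. (\<Sum>i<d. y i * real_of_int (a i)) \<le> s"
  proof (rule Suc.IH)
    show "finite S'"
      using fin by (auto simp: S'_def)
  next
    fix a s assume "(a, s) \<in> S'"
    then show "C a s"
    proof (cases "(a, s) \<in> Z")
      case False
      then obtain p q where pq: "p \<in> P" "q \<in> Q" "(a, s) = comb (p, q)"
        using \<open>(a, s) \<in> S'\<close> by (auto simp: S'_def)
      have "C (fst p) (snd p)" "C (fst q) (snd q)"
        using pq Suc.prems(2) by (auto simp: P_def Q_def)
      then have "C (\<lambda>i. fst p d * fst q i + (- fst q d) * fst p i)
          (real_of_int (fst p d) * snd q + real_of_int (- fst q d) * snd p)"
        using pq(1,2) by (intro add scale') (auto simp: P_def Q_def)
      then show ?thesis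
        using pq(3) by (simp add: comb_def)
    qed (use Suc.prems(2) in \<open>auto simp: Z_def\<close>)
  next
    fix a s i assume as: "(a, s) \<in> S'" and "d \<le> i"
    consider "i = d" | "Suc d \<le> i"
      using \<open>d \<le> i\<close> by linarith
    then show "a i = 0"
    proof cases
      case 1
      then show ?thesis
        using as by (auto simp: S'_def Z_def comb_def)
    next
      case 2
      then have i: "\<forall>x\<in>S. fst x i = 0"
        using Suc.prems(3) by fastforce
      show ?thesis
      proof (cases "(a, s) \<in> Z")
        case False
        then obtain p q where "p \<in> P" "q \<in> Q" "(a, s) = comb (p, q)"
          using as by (auto simp: S'_def)
        moreover from this have "fst p i = 0" "fst q i = 0"
          using i by (auto simp: P_def Q_def)
        ultimately show ?thesis
          by (simp add: comb_def)
      qed (use i in \<open>auto simp: Z_def\<close>)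
    qed
  qed
  then obtain y where y: "\<And>x. x \<in> S' \<Longrightarrow> (\<Sum>i<d. y i * real_of_int (fst x i)) \<le> snd x"
    by fastforce
  define Y where "Y x = (\<Sum>i<d. y i * real_of_int (fst x i))" for x :: "(nat \<Rightarrow> int) \<times> real"
  \<comment> \<open>With the first \<open>d\<close> variables fixed at \<open>y\<close>,
    \<open>bound x\<close> is the value of variable \<open>d\<close> at which \<open>x\<close>
    becomes an equality. It is an upper bound for \<open>x\<close> in \<open>P\<close> and a lower
    bound for \<open>x\<close> in \<open>Q\<close>, where the division by a negative number reverses
    the inequality.\<close>
  define bound where "bound x = (snd x - Y x) / real_of_int (fst x d)" for x
  have sep: "bound q \<le> bound p" if "p \<in> P" "q \<in> Q" for p q
  proof -
    have "comb (p, q) \<in> S'"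
      using that by (auto simp: S'_def)
    then have "Y (comb (p, q)) \<le> snd (comb (p, q))"
      unfolding Y_def by (rule y)
    moreover have "Y (comb (p, q)) = real_of_int (fst p d) * Y q - real_of_int (fst q d) * Y p"
      by (simp add: Y_def comb_def sum_distrib_left algebra_simps sum_subtractf)
    ultimately have "real_of_int (fst p d) * (Y q - snd q) \<le> real_of_int (fst q d) * (Y p - snd p)"
      by (simp add: comb_def algebra_simps)
    moreover have "0 < real_of_int (fst p d)" "real_of_int (fst q d) < 0"
      using that by (auto simp: P_def Q_def)
    ultimately show ?thesis
      by (simp add: bound_def divide_simps algebra_simps)
  qed
  then have "\<exists>t. (\<forall>l\<in>bound ` Q. l \<le> t) \<and> (\<forall>u\<in>bound ` P. t \<le> u)"
    using fin by (intro finite_sets_separation) auto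
  then obtain t where t: "\<And>q. q \<in> Q \<Longrightarrow> bound q \<le> t" "\<And>p. p \<in> P \<Longrightarrow> t \<le> bound p"
    by auto
  have "Y x + t * real_of_int (fst x d) \<le> snd x" if x: "x \<in> S" for x
  proof -
    consider "x \<in> P" | "x \<in> Q" | "x \<in> Z"
      using x by (cases "fst x d" "0 :: int" rule: linorder_cases) (auto simp: P_def Q_def Z_def)
    then show ?thesis
    proof cases
      case 1
      then have "0 < real_of_int (fst x d)"
        by (simp add: P_def)
      with t(2)[OF 1] show ?thesis
        by (simp add: bound_def field_simps)
    next
      case 2
      then have "real_of_int (fst x d) < 0"
        by (simp add: Q_def)
      with t(1)[OF 2] show ?thesis
        by (simp add: bound_def field_simps)
    next
      case 3
      then show ?thesis
        using y[of x] by (simp add: Z_def S'_def Y_def)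
    qed
  qed
  then show ?case
    by (intro exI[of _ "y(d := t)"]) (auto simp: Y_def)
qed

subsection \<open>Standard monomials of the initial ideal\<close>

text \<open>A linear functional of \<open>f\<close>, which detects membership in the toric ideal
  when \<open>G\<close> runs through the fibers. Restricting to the keys of \<open>f\<close> keeps
  the sum finite for infinite fibers.\<close>

definition fiber_sum :: "expo set \<Rightarrow> 'k::field mpoly \<Rightarrow> 'k" where
  "fiber_sum G f = (\<Sum>x\<in>Poly_Mapping.keys f \<inter> G. Poly_Mapping.lookup f x)"

lemma fiber_sum_superset:
  assumes "finite T" "Poly_Mapping.keys f \<subseteq> T"
  shows "fiber_sum G f = (\<Sum>x\<in>T \<inter> G. Poly_Mapping.lookup f x)"
  unfolding fiber_sum_def using assms
  by (intro sum.mono_neutral_left) (auto simp: in_keys_iff)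

lemma fiber_sum_zero [simp]: "fiber_sum G 0 = 0"
  by (simp add: fiber_sum_def)

lemma fiber_sum_add: "fiber_sum G (f + g) = fiber_sum G f + fiber_sum G g"
proof -
  let ?T = "Poly_Mapping.keys f \<union> Poly_Mapping.keys g"
  show ?thesis
    using keys_add[of f g]
    by (simp add: fiber_sum_superset[of ?T] lookup_add sum.distrib)
qed

lemma fiber_sum_single: "fiber_sum G (Poly_Mapping.single x a) = (if x \<in> G then a else 0)"
  by (simp add: fiber_sum_superset[of "{x}"])

lemma fiber_sum_diff: "fiber_sum G (f - g) = fiber_sum G f - fiber_sum G g"
  using fiber_sum_add[of G "f - g" g] by simp

lemma fiber_sum_sum: "fiber_sum G (\<Sum>i\<in>I. f i) = (\<Sum>i\<in>I. fiber_sum G (f i))"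
  by (induction I rule: infinite_finite_induct) (auto simp: fiber_sum_add)

lemma poly_mapping_sum_singles:
  "(\<Sum>x\<in>Poly_Mapping.keys f. Poly_Mapping.single x (Poly_Mapping.lookup f x)) = f"
  by (rule poly_mapping_eqI)
    (auto simp: lookup_sum lookup_single when_def in_keys_iff sum.delta)

text \<open>Multiplication by a monomial translates all exponents by \<open>t\<close>, so
  \<open>G\<close> is replaced by its preimage under this translation.\<close>

lemma fiber_sum_single_times:
  "fiber_sum G (Poly_Mapping.single t a * f) = a * fiber_sum {y. t + y \<in> G} f"
proof -
  have "Poly_Mapping.single t a * f = (\<Sum>y\<in>Poly_Mapping.keys f.
      Poly_Mapping.single (t + y) (a * Poly_Mapping.lookup f y))"
    by (subst (1) poly_mapping_sum_singles[of f, symmetric]) (simp add: sum_distrib_left mult_single)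
  then have "fiber_sum G (Poly_Mapping.single t a * f) =
      (\<Sum>y\<in>Poly_Mapping.keys f. if t + y \<in> G then a * Poly_Mapping.lookup f y else 0)"
    by (simp add: fiber_sum_sum fiber_sum_single)
  also have "\<dots> = a * fiber_sum {y. t + y \<in> G} f"
    by (auto simp: fiber_sum_def sum_distrib_left sum.inter_restrict intro!: sum.cong)
  finally show ?thesis .
qed

text \<open>Additive inverses come from multiplication by the constant polynomial
  \<open>- 1\<close>. The criterion serves to bound a generated ideal from above by a set that is
  described through exponents and coefficients.\<close>

lemma mpoly_idealI:
  fixes I :: "'k::field mpoly set"
  assumes "\<And>f. f \<in> I \<Longrightarrow> Poly_Mapping.keys f \<subseteq> expos n"
    and "0 \<in> I" "\<And>f g. f \<in> I \<Longrightarrow> g \<in> I \<Longrightarrow> f + g \<in> I"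
    and mult: "\<And>p f. Poly_Mapping.keys p \<subseteq> expos n \<Longrightarrow> f \<in> I \<Longrightarrow> p * f \<in> I"
  shows "ideal I (mpoly_ring n)"
proof -
  interpret cring "mpoly_ring n :: 'k mpoly ring"
    by (rule cring_mpoly_ring)
  have neg: "- f \<in> I" if "f \<in> I" for f
    using mult[of "- 1" f] that by (simp add: expos_def in_keys_iff subset_iff lookup_one when_def)
  show ?thesis
  proof (rule idealI)
    show "subgroup I (add_monoid (mpoly_ring n))"
    proof (rule add.subgroupI)
      fix f assume f: "f \<in> I"
      have "\<ominus>\<^bsub>mpoly_ring n\<^esub> f = - f"
        using f neg[OF f] assms(1) by (intro minus_equality) (auto simp: mpoly_ring_def)
      then show "\<ominus>\<^bsub>mpoly_ring n\<^esub> f \<in> I"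
        using neg[OF f] by simp
    qed (use assms in \<open>auto simp: mpoly_ring_def\<close>)
  next
    fix f p :: "'k mpoly" assume "f \<in> I" "p \<in> carrier (mpoly_ring n)"
    then show "p \<otimes>\<^bsub>mpoly_ring n\<^esub> f \<in> I" "f \<otimes>\<^bsub>mpoly_ring n\<^esub> p \<in> I"
      using mult[of p f] by (auto simp: mpoly_ring_def mult.commute)
  qed (rule ring_axioms)
qed

section \<open>Weights and fibers under translation of exponents\<close>

lemma weight_eq_sum:
  "c \<in> carrier_vec n \<Longrightarrow> weight c u = (\<Sum>j<n. c $ j * real (Poly_Mapping.lookup u j))"
  by (simp add: weight_def expo_vec_def scalar_prod_def lessThan_atLeast0)

lemma weight_add: "weight c (u + v) = weight c u + weight c v"
  unfolding weight_eq_sum[OF carrier_vec_dim_vec]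
  by (simp add: lookup_add algebra_simps sum.distrib)

lemma feasible_iff:
  assumes "A \<in> carrier_mat d n"
  shows "x \<in> feasible A u \<longleftrightarrow> x \<in> expos n \<and>
    (\<forall>i<d. (\<Sum>j<n. A $$ (i, j) * int (Poly_Mapping.lookup x j)) =
           (\<Sum>j<n. A $$ (i, j) * int (Poly_Mapping.lookup u j)))"
  using assms
  by (auto simp: feasible_def vec_eq_iff expo_vec_def scalar_prod_def lessThan_atLeast0)

lemma expos_add: "u \<in> expos n \<Longrightarrow> v \<in> expos n \<Longrightarrow> u + v \<in> expos n"
  using keys_add[of u v] by (auto simp: expos_def)

text \<open>By linearity of \<open>A\<close>, the preimage of a fiber under translation by
  \<open>t\<close> is again a fiber, that of \<open>y'\<close>, as soon as it contains some
  \<open>y'\<close> at all.\<close>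

lemma feasible_add_iff:
  assumes "A \<in> carrier_mat d n" "t \<in> expos n" "y \<in> expos n" "y' \<in> expos n" "t + y' \<in> feasible A u"
  shows "t + y \<in> feasible A u \<longleftrightarrow> y \<in> feasible A y'"
proof -
  define L where "L x i = (\<Sum>j<n. A $$ (i, j) * int (Poly_Mapping.lookup x j))" for x i
  have L_add: "L (t + x) i = L t i + L x i" for x i
    by (simp add: L_def lookup_add distrib_left sum.distrib)
  note feas = feasible_iff[OF assms(1), folded L_def]
  have "L (t + y) i = L u i \<longleftrightarrow> L y i = L y' i" if "i < d" for i
  proof -
    have "L t i + L y' i = L u i"
      using assms(5) that unfolding feas L_add by blast
    then show ?thesis
      unfolding L_add by linarith
  qed
  then show ?thesis
    unfolding feas using assms(2,3) expos_add by blast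
qed

lemma feasible_add:
  assumes "A \<in> carrier_mat d n" "t \<in> expos n" "y \<in> feasible A y'"
  shows "t + y \<in> feasible A (t + y')"
  using assms(2-)
  by (auto simp: feasible_iff[OF assms(1)] lookup_add algebra_simps sum.distrib expos_add)

lemma keys_mult_expos:
  assumes "Poly_Mapping.keys p \<subseteq> expos n" "Poly_Mapping.keys f \<subseteq> expos n"
  shows "Poly_Mapping.keys (p * f) \<subseteq> expos n"
  using keys_mult[of p f] assms expos_add by blast

lemma keys_binomial:
  "Poly_Mapping.keys (monomial u - monomial v :: 'k::field mpoly) \<subseteq> {u, v}"
  by (auto simp: in_keys_iff lookup_minus lookup_single when_def split: if_splits)

lemma toric_ideal_subset_carrier:
  assumes "A \<in> carrier_mat d n"
  shows "{monomial u - monomial v | u v. u \<in> expos n \<and> v \<in> expos n \<and>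
          A *\<^sub>v expo_vec n u = A *\<^sub>v expo_vec n v} \<subseteq> carrier (mpoly_ring n :: 'k::field mpoly ring)"
proof -
  have "monomial u - monomial v \<in> carrier (mpoly_ring n :: 'k mpoly ring)"
    if "u \<in> expos n" "v \<in> expos n" for u v
    using that keys_binomial[of u v, where 'k = 'k] by (auto simp: mpoly_ring_def)
  then show ?thesis
    by blast
qed

text \<open>Both properties define an ideal: multiplication by a monomial turns the sum over one
  fiber into a multiple of the sum over another fiber, or into an empty sum. The generating
  binomials have both exponents in one fiber, where the coefficients 1 and -1 cancel.\<close>

lemma toric_ideal_fiber_sum:
  fixes f :: "'k::field mpoly"
  assumes A: "A \<in> carrier_mat d n" and "f \<in> toric_ideal A"
  shows "Poly_Mapping.keys f \<subseteq> expos n" "fiber_sum (feasible A u) f = 0"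
proof -
  interpret cring "mpoly_ring n :: 'k mpoly ring"
    by (rule cring_mpoly_ring)
  \<comment> \<open>All fibers are treated at once, because multiplication by a monomial changes the
    fiber.\<close>
  define K where "K = {f :: 'k mpoly. Poly_Mapping.keys f \<subseteq> expos n \<and>
    (\<forall>u. fiber_sum (feasible A u) f = 0)}"
  have "ideal K (mpoly_ring n)"
  proof (rule mpoly_idealI)
    fix p f :: "'k mpoly" assume p: "Poly_Mapping.keys p \<subseteq> expos n" and f: "f \<in> K"
    have "fiber_sum (feasible A u) (Poly_Mapping.single t a * f) = 0" if "t \<in> expos n" for t a u
    proof (cases "\<exists>y\<in>expos n. t + y \<in> feasible A u")
      case True
      then obtain y' where "y' \<in> expos n" "t + y' \<in> feasible A u"
        by blast
      then have "Poly_Mapping.keys f \<inter> {y. t + y \<in> feasible A u} =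
          Poly_Mapping.keys f \<inter> feasible A y'"
        using feasible_add_iff[OF A that, of _ y' u] f by (auto simp: K_def)
      then have "fiber_sum {y. t + y \<in> feasible A u} f = fiber_sum (feasible A y') f"
        by (simp add: fiber_sum_def)
      then show ?thesis
        using f by (simp add: fiber_sum_single_times K_def)
    next
      case False
      then have "Poly_Mapping.keys f \<inter> {y. t + y \<in> feasible A u} = {}"
        using f by (auto simp: K_def)
      then show ?thesis
        unfolding fiber_sum_single_times by (simp add: fiber_sum_def)
    qed
    then have "fiber_sum (feasible A u)
      ((\<Sum>x\<in>Poly_Mapping.keys p. Poly_Mapping.single x (Poly_Mapping.lookup p x)) * f) = 0" for u
      using p by (auto simp: sum_distrib_right fiber_sum_sum intro!: sum.neutral)
    then show "p * f \<in> K"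
      using keys_mult_expos[OF p] f by (simp add: K_def poly_mapping_sum_singles)
  next
    fix f g assume "f \<in> K" "g \<in> K"
    then show "f + g \<in> K"
      using keys_add[of f g] by (auto simp: K_def fiber_sum_add)
  qed (auto simp: K_def)
  moreover have "{monomial u - monomial v | u v. u \<in> expos n \<and> v \<in> expos n \<and>
          A *\<^sub>v expo_vec n u = A *\<^sub>v expo_vec n v} \<subseteq> K"
  proof -
    have "monomial x - monomial y \<in> K"
      if xy: "x \<in> expos n" "y \<in> expos n" "A *\<^sub>v expo_vec n x = A *\<^sub>v expo_vec n y" for x y
    proof -
      have "x \<in> feasible A u \<longleftrightarrow> y \<in> feasible A u" for u
        using xy A by (simp add: feasible_def Let_def)
      then show ?thesis
        using keys_binomial[of x y, where 'k = 'k] xy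
        by (auto simp: K_def fiber_sum_diff fiber_sum_single)
    qed
    then show ?thesis
      by blast
  qed
  ultimately have "toric_ideal A \<subseteq> K"
    unfolding toric_ideal_def Let_def carrier_matD(2)[OF A] by (rule genideal_minimal)
  then show "Poly_Mapping.keys f \<subseteq> expos n" "fiber_sum (feasible A u) f = 0"
    using assms(2) by (auto simp: K_def)
qed

section \<open>Suboptimal exponents and the initial ideal\<close>

definition suboptimal :: "int mat \<Rightarrow> real vec \<Rightarrow> expo \<Rightarrow> bool" where
  "suboptimal A c u \<longleftrightarrow> (\<exists>v\<in>feasible A u. weight c v < weight c u)"

text \<open>Here \<open>u\<close> is an optimum of its fiber, and a feasible \<open>v\<close> of no
  larger weight is another one; genericity leaves room for only one.\<close>

lemma generic_cost_unique:
  assumes "generic_cost A c" "u \<in> expos (dim_col A)" "\<not> suboptimal A c u"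
    and "v \<in> feasible A u" "weight c v \<le> weight c u"
  shows "v = u"
proof -
  have "u \<in> feasible A u"
    using assms(2) by (simp add: feasible_def Let_def)
  moreover have "\<forall>y\<in>feasible A u. weight c u \<le> weight c y"
    using assms(3) by (auto simp: suboptimal_def not_less)
  moreover have "\<forall>y\<in>feasible A u. weight c v \<le> weight c y"
    using calculation(2) assms(5) by auto
  ultimately show ?thesis
    using assms(1,2,4) unfolding generic_cost_def by blast
qed

lemma keys_initial_form:
  "Poly_Mapping.keys (initial_form c f) \<subseteq>
    {u \<in> Poly_Mapping.keys f. \<forall>v\<in>Poly_Mapping.keys f. weight c v \<le> weight c u}"
  by (auto simp: initial_form_def in_keys_iff lookup_sum lookup_single when_def
      dest!: sum.not_neutral_contains_not_neutral split: if_splits)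

text \<open>If \<open>v\<close> improves on \<open>u\<close>, then \<open>monomial u\<close> is the
  initial form of \<open>monomial u - monomial v\<close>. Conversely, the polynomials with only
  suboptimal exponents form an ideal, since adding \<open>x\<close> to an exponent and to its
  improvement preserves the improvement, and this ideal contains all initial forms.\<close>

lemma monomial_in_initial_ideal_iff:
  assumes A: "A \<in> carrier_mat d n" and c: "c \<in> carrier_vec n" and gen: "generic_cost A c"
    and u: "u \<in> expos n"
  shows "(monomial u :: 'k::field mpoly) \<in> initial_ideal c (toric_ideal A) \<longleftrightarrow> suboptimal A c u"
proof -
  let ?R = "mpoly_ring n :: 'k mpoly ring"
  let ?T = "toric_ideal A :: 'k mpoly set"
  interpret cring ?R
    by (rule cring_mpoly_ring)
  have n: "dim_col A = n" "dim_vec c = n"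
    using A c by auto
  have carr: "initial_form c ` ?T \<subseteq> carrier ?R"
  proof -
    have "initial_form c f \<in> carrier ?R" if "f \<in> ?T" for f
      using keys_initial_form[of c f] toric_ideal_fiber_sum(1)[OF A that]
      by (auto simp: mpoly_ring_def)
    then show ?thesis
      by blast
  qed
  show ?thesis
  proof
    assume "suboptimal A c u"
    then obtain v where v: "v \<in> feasible A u" "weight c v < weight c u"
      by (auto simp: suboptimal_def)
    then have "v \<in> expos n" "A *\<^sub>v expo_vec n u = A *\<^sub>v expo_vec n v"
      using n by (auto simp: feasible_def Let_def)
    then have "monomial u - monomial v \<in> ?T"
      using genideal_self[OF toric_ideal_subset_carrier[OF A, where 'k = 'k]] u
      unfolding toric_ideal_def Let_def n by blast
    moreover have "initial_form c (monomial u - monomial v :: 'k mpoly) = monomial u"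
    proof -
      have "u \<noteq> v"
        using v by auto
      then have "Poly_Mapping.keys (monomial u - monomial v :: 'k mpoly) = {u, v}"
        by (auto simp: in_keys_iff lookup_minus lookup_single when_def split: if_splits)
      then have "{x \<in> Poly_Mapping.keys (monomial u - monomial v :: 'k mpoly).
          \<forall>y\<in>Poly_Mapping.keys (monomial u - monomial v :: 'k mpoly). weight c y \<le> weight c x} = {u}"
        using v by auto
      then show ?thesis
        using \<open>u \<noteq> v\<close> by (simp add: initial_form_def lookup_minus lookup_single when_def)
    qed
    ultimately have "monomial u \<in> initial_form c ` ?T"
      by (metis image_eqI)
    then show "(monomial u :: 'k mpoly) \<in> initial_ideal c ?T"
      using genideal_self[OF carr] n by (auto simp: initial_ideal_def)
  next
    define K where "K = {f :: 'k mpoly. Poly_Mapping.keys f \<subseteq> {u \<in> expos n. suboptimal A c u}}"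
    have sub: "suboptimal A c (x + y)" if "x \<in> expos n" "suboptimal A c y" for x y
      using that feasible_add[OF A] by (force simp: suboptimal_def weight_add)
    have "ideal K ?R"
    proof (rule mpoly_idealI)
      fix p f :: "'k mpoly" assume pf: "Poly_Mapping.keys p \<subseteq> expos n" "f \<in> K"
      have "x \<in> expos n \<and> suboptimal A c x" if x: "x \<in> Poly_Mapping.keys (p * f)" for x
      proof -
        obtain s t where "s \<in> Poly_Mapping.keys p" "t \<in> Poly_Mapping.keys f" "x = s + t"
          using keys_mult[of p f] x by blast
        then show ?thesis
          using pf by (auto simp: K_def intro!: sub expos_add)
      qed
      then show "p * f \<in> K"
        by (auto simp: K_def)
    next
      fix f g assume "f \<in> K" "g \<in> K"
      then show "f + g \<in> K"
        using keys_add[of f g] by (auto simp: K_def)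
    qed (auto simp: K_def)
    moreover have "initial_form c f \<in> K" if f: "f \<in> ?T" for f
    proof -
      have "suboptimal A c x"
        if x: "x \<in> Poly_Mapping.keys f" "\<forall>y\<in>Poly_Mapping.keys f. weight c y \<le> weight c x" for x
      proof (rule ccontr)
        assume opt: "\<not> suboptimal A c x"
        have "x \<in> expos n"
          using x toric_ideal_fiber_sum(1)[OF A f] by auto
        \<comment> \<open>No exponent of \<open>f\<close> is heavier than the optimal
          \<open>x\<close>, so by uniqueness \<open>x\<close> is the only one in its fiber. Its
          nonzero coefficient is then the whole fiber sum, which must vanish.\<close>
        then have "Poly_Mapping.keys f \<inter> feasible A x = {x}"
          using generic_cost_unique[OF gen _ opt] x n by (auto simp: feasible_def Let_def)
        then have "fiber_sum (feasible A x) f = Poly_Mapping.lookup f x"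
          by (simp add: fiber_sum_def)
        then show False
          using toric_ideal_fiber_sum(2)[OF A f] x by (simp add: in_keys_iff)
      qed
      then show ?thesis
        using keys_initial_form[of c f] toric_ideal_fiber_sum(1)[OF A f] by (auto simp: K_def)
    qed
    ultimately have "initial_ideal c ?T \<subseteq> K"
      using genideal_minimal[of K "initial_form c ` ?T"] n by (auto simp: initial_ideal_def)
    moreover assume "(monomial u :: 'k mpoly) \<in> initial_ideal c ?T"
    ultimately show "suboptimal A c u"
      by (auto simp: K_def)
  qed
qed

subsection \<open>Submatrices and complementary bases\<close>

lemma bij_betw_pick:
  assumes "finite I"
  shows "bij_betw (pick I) {..<card I} I"
  unfolding bij_betw_def
proof
  show "inj_on (pick I) {..<card I}"
    by (rule linorder_inj_onI) (auto dest: pick_mono[of _ I, OF disjI1])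
  have "i \<in> pick I ` {..<card I}" if "i \<in> I" for i
  proof -
    have "card {a \<in> I. a < i} < card I"
      using that assms by (intro psubset_card_mono) auto
    then show ?thesis
      using pick_card_in_set[OF that]
      by (intro image_eqI[where x = "card {a \<in> I. a < i}"]) simp_all
  qed
  then show "pick I ` {..<card I} = I"
    using pick_in_set by fastforce
qed

lemma ex_pick:
  assumes "finite I" "i \<in> I"
  shows "\<exists>k<card I. i = pick I k"
proof -
  have "i \<in> pick I ` {..<card I}"
    using bij_betw_pick[OF assms(1)] assms(2) by (simp add: bij_betw_def)
  then show ?thesis
    by auto
qed

lemma sum_pick:
  "finite I \<Longrightarrow> (\<Sum>k<card I. f (pick I k)) = sum f I"
  by (rule sum.reindex_bij_betw[OF bij_betw_pick])

lemma pick_in_set': "k < card I \<Longrightarrow> pick I k \<in> I"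
  by (rule pick_in_set[OF disjI1])

lemma pick_atLeastLessThan:
  assumes "k < n - m"
  shows "pick {m..<n} k = m + k"
proof -
  have "{a \<in> {m..<n}. a < m + k} = {m..<m + k}"
    using assms by auto
  then show ?thesis
    using pick_card_in_set[of "m + k" "{m..<n}"] assms by simp
qed

lemma cols_at_carrier:
  assumes "A \<in> carrier_mat d n" "\<sigma> \<subseteq> {..<n}"
  shows "cols_at A \<sigma> \<in> carrier_mat d (card \<sigma>)"
proof -
  have "{j. j < n \<and> j \<in> \<sigma>} = \<sigma>" "{i. i < d \<and> i \<in> (UNIV :: nat set)} = {..<d}"
    using assms(2) by auto
  then show ?thesis
    using assms(1) dim_submatrix[of A UNIV \<sigma>] by (intro carrier_matI) (auto simp: cols_at_def)
qed

lemma cols_at_index: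
  assumes "A \<in> carrier_mat d n" "\<sigma> \<subseteq> {..<n}" "i < d" "k < card \<sigma>"
  shows "cols_at A \<sigma> $$ (i, k) = A $$ (i, pick \<sigma> k)"
proof -
  have "{j. j < n \<and> j \<in> \<sigma>} = \<sigma>" "{i. i < d \<and> i \<in> (UNIV :: nat set)} = {..<d}"
    using assms(2) by auto
  then show ?thesis
    using assms submatrix_index[of i A UNIV k \<sigma>] by (simp add: cols_at_def pick_UNIV)
qed

lemma subvec_eq:
  assumes "v \<in> carrier_vec n" "\<tau> \<subseteq> {..<n}"
  shows "subvec v \<tau> = vec (card \<tau>) (\<lambda>k. v $ pick \<tau> k)"
proof -
  have "{i. i < n \<and> i \<in> \<tau>} = \<tau>"
    using assms(2) by auto
  then show ?thesis
    using assms(1) by (simp add: subvec_def)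
qed

lemma map_mat_cols_at:
  assumes "A \<in> carrier_mat d n" "\<sigma> \<subseteq> {..<n}"
  shows "map_mat f (cols_at A \<sigma>) = cols_at (map_mat f A) \<sigma>"
proof -
  have "pick \<sigma> k < n" if "k < card \<sigma>" for k
    using pick_in_set'[OF that] assms(2) by auto
  then show ?thesis
    using cols_at_carrier[OF assms] cols_at_carrier[OF map_carrier_mat[THEN iffD2, OF assms(1)] assms(2), of f] assms
    by (intro eq_matI) (auto simp: cols_at_index[OF assms]
        cols_at_index[OF map_carrier_mat[THEN iffD2, OF assms(1)] assms(2)])
qed

lemma cols_at_mult_vec:
  fixes A :: "'a::comm_semiring_0 mat"
  assumes "A \<in> carrier_mat d n" "\<sigma> \<subseteq> {..<n}"
  shows "cols_at A \<sigma> *\<^sub>v vec (card \<sigma>) (\<lambda>k. z (pick \<sigma> k)) = vec d (\<lambda>i. \<Sum>j\<in>\<sigma>. A $$ (i, j) * z j)"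
proof -
  have "finite \<sigma>"
    using assms(2) finite_subset by blast
  have "(cols_at A \<sigma> *\<^sub>v vec (card \<sigma>) (\<lambda>k. z (pick \<sigma> k))) $ i = (\<Sum>j\<in>\<sigma>. A $$ (i, j) * z j)"
    if "i < d" for i
  proof -
    have "(cols_at A \<sigma> *\<^sub>v vec (card \<sigma>) (\<lambda>k. z (pick \<sigma> k))) $ i =
        (\<Sum>k<card \<sigma>. A $$ (i, pick \<sigma> k) * z (pick \<sigma> k))"
      using cols_at_carrier[OF assms] that
      by (auto simp: scalar_prod_def cols_at_index[OF assms] lessThan_atLeast0)
    also have "\<dots> = (\<Sum>j\<in>\<sigma>. A $$ (i, j) * z j)"
      by (rule sum_pick[OF \<open>finite \<sigma>\<close>])
    finally show ?thesis .
  qed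
  then show ?thesis
    using cols_at_carrier[OF assms] by (intro eq_vecI) auto
qed

lemma vec_pick_cases:
  fixes v :: "'a::zero vec"
  assumes "v \<in> carrier_vec (card \<sigma>)" "finite \<sigma>"
  obtains z where "v = vec (card \<sigma>) (\<lambda>k. z (pick \<sigma> k))" "\<And>j. j \<notin> \<sigma> \<Longrightarrow> z j = 0"
proof
  \<comment> \<open>The number of elements of \<sigma> below \<open>j\<close> is the position of
    \<open>j\<close> in \<sigma>, so it inverts \<open>pick \<sigma>\<close>.\<close>
  let ?z = "\<lambda>j. if j \<in> \<sigma> then v $ card {a \<in> \<sigma>. a < j} else 0"
  show "v = vec (card \<sigma>) (\<lambda>k. ?z (pick \<sigma> k))"
    using assms by (intro eq_vecI) (auto simp: pick_in_set' card_pick)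
qed simp

lemma transpose_cols_at_mult_vec:
  fixes A :: "'a::comm_semiring_0 mat"
  assumes "A \<in> carrier_mat d n" "\<sigma> \<subseteq> {..<n}" "u \<in> carrier_vec d"
  shows "transpose_mat (cols_at A \<sigma>) *\<^sub>v u =
    vec (card \<sigma>) (\<lambda>k. \<Sum>i<d. A $$ (i, pick \<sigma> k) * u $ i)"
  using cols_at_carrier[OF assms(1,2)] assms(3)
  by (intro eq_vecI) (auto simp: scalar_prod_def cols_at_index[OF assms(1,2)] lessThan_atLeast0)

section \<open>Kernels, determinants and inverses\<close>

lemma wide_matrix_kernel:
  fixes A :: "'a::idom mat"
  assumes "A \<in> carrier_mat d m" "d < m"
  shows "\<exists>v. v \<in> carrier_vec m \<and> v \<noteq> 0\<^sub>v m \<and> A *\<^sub>v v = 0\<^sub>v d"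
proof -
  \<comment> \<open>Zero rows fill the matrix up to a square one. Its last row is zero because
    \<open>d < m\<close>, so the last unit vector is in the kernel of the transpose and the
    determinant vanishes. Working with determinants over an integral domain gives integer kernel
    vectors for integer matrices.\<close>
  define P where "P = mat m m (\<lambda>(i, j). if i < d then A $$ (i, j) else 0)"
  have P: "P \<in> carrier_mat m m"
    by (simp add: P_def)
  have "transpose_mat P *\<^sub>v unit_vec m (m - 1) = 0\<^sub>v m"
    using assms(2) by (intro eq_vecI) (auto simp: P_def)
  moreover have "unit_vec m (m - 1) \<noteq> (0\<^sub>v m :: 'a vec)"
    using assms(2) by simp
  ultimately have "det (transpose_mat P) = 0"
    using P by (subst det_0_iff_vec_prod_zero[of _ m]) (auto intro!: exI[of _ "unit_vec m (m - 1)"])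
  then have "det P = 0"
    using det_transpose[OF P] by simp
  then obtain v where v: "v \<in> carrier_vec m" "v \<noteq> 0\<^sub>v m" "P *\<^sub>v v = 0\<^sub>v m"
    using det_0_iff_vec_prod_zero[OF P] by auto
  have "(A *\<^sub>v v) $ i = (P *\<^sub>v v) $ i" if "i < d" for i
    using that assms v(1) by (auto simp: P_def scalar_prod_def intro!: sum.cong)
  then have "A *\<^sub>v v = 0\<^sub>v d"
    using v(3) assms by (intro eq_vecI) auto
  then show ?thesis
    using v by blast
qed

lemma det_nonzero_kernel:
  fixes A :: "'a::idom mat"
  assumes "A \<in> carrier_mat n n" "det A \<noteq> 0" "v \<in> carrier_vec n" "A *\<^sub>v v = 0\<^sub>v n"
  shows "v = 0\<^sub>v n"
  using assms det_0_iff_vec_prod_zero by blast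

lemma det_nonzero_mat_inverse:
  fixes A :: "'a::field mat"
  assumes "A \<in> carrier_mat n n" "det A \<noteq> 0"
  shows "the (mat_inverse A) \<in> carrier_mat n n"
    and "A * the (mat_inverse A) = 1\<^sub>m n" "the (mat_inverse A) * A = 1\<^sub>m n"
proof -
  have "mat_inverse A \<noteq> None"
    using mat_inverse(1)[OF assms(1), where b = "()"] det_non_zero_imp_unit[OF assms, where b = "()"] by blast
  then show "the (mat_inverse A) \<in> carrier_mat n n"
    "A * the (mat_inverse A) = 1\<^sub>m n" "the (mat_inverse A) * A = 1\<^sub>m n"
    using mat_inverse(2)[OF assms(1)] by auto
qed

lemma det_nonzero_invertible_mat:
  fixes A :: "'a::field mat"
  assumes "A \<in> carrier_mat n n" "det A \<noteq> 0"
  shows "invertible_mat A"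
  using det_nonzero_mat_inverse[OF assms] assms(1)
  by (auto simp: invertible_mat_def inverts_mat_def intro!: exI[of _ "the (mat_inverse A)"])

lemma sum_lessThan_subset_diff:
  "\<sigma> \<subseteq> {..<n::nat} \<Longrightarrow> sum f {..<n} = sum f \<sigma> + sum f ({..<n} - \<sigma>)"
  by (metis add.commute finite_lessThan sum.subset_diff)

section \<open>Complementary column sets of two matrices with orthogonal rows\<close>

context
  fixes A H :: "real mat" and d n :: nat and \<sigma> :: "nat set"
  assumes A: "A \<in> carrier_mat d n" and H: "H \<in> carrier_mat (n - d) n"
    and dn: "d \<le> n" and \<sigma>: "\<sigma> \<subseteq> {..<n}" "card \<sigma> = d"
    and orth: "\<And>i k. i < d \<Longrightarrow> k < n - d \<Longrightarrow> (\<Sum>j<n. A $$ (i, j) * H $$ (k, j)) = 0"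
    and A_\<sigma>: "det (cols_at A \<sigma>) \<noteq> 0"
begin

lemma row_space_orthogonal:
  assumes "i < d"
  shows "(\<Sum>j<n. A $$ (i, j) * (\<Sum>k<n - d. H $$ (k, j) * u k)) = 0"
proof -
  have "(\<Sum>j<n. A $$ (i, j) * (\<Sum>k<n - d. H $$ (k, j) * u k)) =
      (\<Sum>k<n - d. u k * (\<Sum>j<n. A $$ (i, j) * H $$ (k, j)))"
    unfolding sum_distrib_left by (subst sum.swap) (simp add: mult_ac)
  then show ?thesis
    using orth[OF assms] by simp
qed

lemma card_complement: "card ({..<n} - \<sigma>) = n - d"
  using \<sigma> by (simp add: card_Diff_subset finite_subset)

lemma complement_carrier: "cols_at H ({..<n} - \<sigma>) \<in> carrier_mat (n - d) (n - d)"
  using cols_at_carrier[OF H, of "{..<n} - \<sigma>"] card_complement by simp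

text \<open>A kernel vector of the transposed submatrix gives a combination \<open>g\<close> of the
  rows of \<open>H\<close> that vanishes off \<sigma>. As \<open>A\<close> annihilates
  \<open>g\<close> and its columns in \<sigma> are independent, \<open>g\<close> vanishes on
  \<sigma> too. The assumption \<open>inj\<close>, independence of the rows of \<open>H\<close>,
  then kills the coefficients.\<close>

lemma det_complement_nonzero:
  assumes inj: "\<And>u. (\<And>j. j < n \<Longrightarrow> (\<Sum>k<n - d. H $$ (k, j) * u k) = 0) \<Longrightarrow> \<forall>k<n - d. u k = 0"
  shows "det (cols_at H ({..<n} - \<sigma>)) \<noteq> 0"
proof
  let ?\<beta> = "{..<n} - \<sigma>"
  have \<beta>: "?\<beta> \<subseteq> {..<n}"
    by blast
  assume "det (cols_at H ?\<beta>) = 0"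
  then have "det (transpose_mat (cols_at H ?\<beta>)) = 0"
    using det_transpose[OF complement_carrier] by simp
  then obtain u where u: "u \<in> carrier_vec (n - d)" "u \<noteq> 0\<^sub>v (n - d)"
    "transpose_mat (cols_at H ?\<beta>) *\<^sub>v u = 0\<^sub>v (n - d)"
    using det_0_iff_vec_prod_zero[of "transpose_mat (cols_at H ?\<beta>)" "n - d"] complement_carrier
    by auto
  define g where "g j = (\<Sum>k<n - d. H $$ (k, j) * u $ k)" for j
  have g\<beta>: "g j = 0" if j: "j \<in> ?\<beta>" for j
  proof -
    obtain k where k: "k < n - d" "j = pick ?\<beta> k"
      using ex_pick[of ?\<beta> j] j card_complement by auto
    have "(transpose_mat (cols_at H ?\<beta>) *\<^sub>v u) $ k = g j"
      unfolding transpose_cols_at_mult_vec[OF H \<beta> u(1)] using k by (simp add: g_def card_complement)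
    then show ?thesis
      using u(3) k by simp
  qed
  have "(\<Sum>j\<in>\<sigma>. A $$ (i, j) * g j) = 0" if "i < d" for i
    using row_space_orthogonal[OF that, of "\<lambda>k. u $ k"] g\<beta> unfolding g_def[symmetric]
    by (simp add: sum_lessThan_subset_diff[OF \<sigma>(1)])
  then have "cols_at A \<sigma> *\<^sub>v vec (card \<sigma>) (\<lambda>k. g (pick \<sigma> k)) = 0\<^sub>v d"
    unfolding cols_at_mult_vec[OF A \<sigma>(1)] by (intro eq_vecI) auto
  then have zero: "vec d (\<lambda>k. g (pick \<sigma> k)) = 0\<^sub>v d"
    using det_nonzero_kernel[OF _ A_\<sigma>, of d] cols_at_carrier[OF A \<sigma>(1)] \<sigma>(2) by simp
  have "g j = 0" if j: "j \<in> \<sigma>" for j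
  proof -
    obtain k where "k < d" "j = pick \<sigma> k"
      using ex_pick[of \<sigma> j] j \<sigma> finite_subset[OF \<sigma>(1)] by auto
    then show ?thesis
      using zero by (metis index_vec index_zero_vec(1))
  qed
  then have "\<And>j. j < n \<Longrightarrow> g j = 0"
    using g\<beta> by blast
  then have "\<forall>k<n - d. u $ k = 0"
    using inj[of "\<lambda>k. u $ k"] by (simp add: g_def)
  then have "u = 0\<^sub>v (n - d)"
    using u(1) by (intro eq_vecI) auto
  then show False
    using u(2) by simp
qed

text \<open>Some combination \<open>g\<close> of the rows of \<open>H\<close> agrees with
  \<open>v\<close> off \<sigma>. Since \<open>A\<close> annihilates \<open>g\<close>, subtracting it
  from \<open>v\<close> preserves the product with \<open>A\<close> and leaves a vector supported on
  \<sigma>, whose entries there solve the system. Invertibility of the columns in \<sigma> makes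
  this solution the only one.\<close>

lemma system_solution_complement:
  fixes v :: "real vec"
  assumes v: "v \<in> carrier_vec n" and det: "det (cols_at H ({..<n} - \<sigma>)) \<noteq> 0"
  shows "{x \<in> carrier_vec d. cols_at A \<sigma> *\<^sub>v x = A *\<^sub>v v} =
    {subvec v \<sigma> - transpose_mat (cols_at H \<sigma>) *\<^sub>v
      (transpose_mat (the (mat_inverse (cols_at H ({..<n} - \<sigma>)))) *\<^sub>v subvec v ({..<n} - \<sigma>))}"
    (is "_ = {?x}")
proof -
  let ?\<beta> = "{..<n} - \<sigma>"
  have \<beta>: "?\<beta> \<subseteq> {..<n}"
    by blast
  note inv = det_nonzero_mat_inverse[OF complement_carrier det]
  \<comment> \<open>These are the coefficients of that combination: the transpose of
    \<open>cols_at H ?\<beta>\<close> maps \<open>w\<close> to the part of \<open>v\<close> on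
    \<open>?\<beta>\<close>.\<close>
  define w where "w = transpose_mat (the (mat_inverse (cols_at H ?\<beta>))) *\<^sub>v subvec v ?\<beta>"
  have sub: "subvec v ?\<beta> \<in> carrier_vec (n - d)"
    by (simp add: subvec_eq[OF v \<beta>] card_complement)
  have w: "w \<in> carrier_vec (n - d)"
    using inv(1) sub unfolding w_def
    by (intro mult_mat_vec_carrier[of _ "n - d" "n - d"]) simp_all
  have Hw: "transpose_mat (cols_at H ?\<beta>) *\<^sub>v w = subvec v ?\<beta>"
  proof -
    let ?P = "cols_at H ?\<beta>" and ?Q = "the (mat_inverse (cols_at H ?\<beta>))"
    have "transpose_mat ?P *\<^sub>v w = (transpose_mat ?P * transpose_mat ?Q) *\<^sub>v subvec v ?\<beta>"
      unfolding w_def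
      by (rule assoc_mult_mat_vec[symmetric, OF transpose_carrier_mat[THEN iffD2, OF complement_carrier]
          transpose_carrier_mat[THEN iffD2, OF inv(1)] sub])
    also have "transpose_mat ?P * transpose_mat ?Q = transpose_mat (?Q * ?P)"
      by (rule transpose_mult[symmetric, OF inv(1) complement_carrier])
    also have "\<dots> *\<^sub>v subvec v ?\<beta> = subvec v ?\<beta>"
      unfolding inv(3) using sub by simp
    finally show ?thesis .
  qed
  define g where "g j = (\<Sum>k<n - d. H $$ (k, j) * w $ k)" for j
  have g\<beta>: "g j = v $ j" if j: "j \<in> ?\<beta>" for j
  proof -
    obtain k where k: "k < n - d" "j = pick ?\<beta> k"
      using ex_pick[of ?\<beta> j] j card_complement by auto
    have "(transpose_mat (cols_at H ?\<beta>) *\<^sub>v w) $ k = g j"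
      unfolding transpose_cols_at_mult_vec[OF H \<beta> w] using k by (simp add: g_def card_complement)
    then show ?thesis
      using k unfolding Hw subvec_eq[OF v \<beta>] by (simp add: card_complement)
  qed
  define y where "y = vec d (\<lambda>k. v $ pick \<sigma> k - g (pick \<sigma> k))"
  have x: "?x = y"
    unfolding w_def[symmetric] transpose_cols_at_mult_vec[OF H \<sigma>(1) w] subvec_eq[OF v \<sigma>(1)] \<sigma>(2) y_def
    by (intro eq_vecI) (auto simp: g_def)
  have "(\<Sum>j\<in>\<sigma>. A $$ (i, j) * (v $ j - g j)) = (\<Sum>j<n. A $$ (i, j) * v $ j)" if "i < d" for i
  proof -
    have "(\<Sum>j\<in>\<sigma>. A $$ (i, j) * (v $ j - g j)) = (\<Sum>j<n. A $$ (i, j) * (v $ j - g j))"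
      using g\<beta> by (simp add: sum_lessThan_subset_diff[OF \<sigma>(1)])
    also have "\<dots> = (\<Sum>j<n. A $$ (i, j) * v $ j)"
      using row_space_orthogonal[OF that, of "\<lambda>k. w $ k"] unfolding g_def[symmetric]
      by (simp add: right_diff_distrib sum_subtractf)
    finally show ?thesis .
  qed
  moreover have "cols_at A \<sigma> *\<^sub>v y = vec d (\<lambda>i. \<Sum>j\<in>\<sigma>. A $$ (i, j) * (v $ j - g j))"
    using cols_at_mult_vec[OF A \<sigma>(1), of "\<lambda>j. v $ j - g j"] by (simp add: y_def \<sigma>(2))
  moreover have "A *\<^sub>v v = vec d (\<lambda>i. \<Sum>j<n. A $$ (i, j) * v $ j)"
    using A v by (intro eq_vecI) (auto simp: scalar_prod_def lessThan_atLeast0)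
  ultimately have sol: "cols_at A \<sigma> *\<^sub>v y = A *\<^sub>v v"
    by (auto intro: eq_vecI)
  have carr: "cols_at A \<sigma> \<in> carrier_mat d d" "y \<in> carrier_vec d"
    using cols_at_carrier[OF A \<sigma>(1)] \<sigma>(2) by (auto simp: y_def)
  have "x = y" if x: "x \<in> carrier_vec d" "cols_at A \<sigma> *\<^sub>v x = A *\<^sub>v v" for x
  proof -
    have "A *\<^sub>v v \<in> carrier_vec d"
      using A v by (rule mult_mat_vec_carrier)
    then have "cols_at A \<sigma> *\<^sub>v (x - y) = 0\<^sub>v d"
      unfolding mult_minus_distrib_mat_vec[OF carr(1) x(1) carr(2)] x(2) sol by simp
    then have zero: "x - y = 0\<^sub>v d"
      by (rule det_nonzero_kernel[OF carr(1) A_\<sigma> minus_carrier_vec[OF x(1) carr(2)]])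
    have "x $ i = y $ i" if "i < d" for i
    proof -
      have "(x - y) $ i = 0"
        unfolding zero using that by simp
      then show ?thesis
        using that carr(2) by simp
    qed
    then show ?thesis
      using x(1) carr(2) by (intro eq_vecI) auto
  qed
  then have "{x \<in> carrier_vec d. cols_at A \<sigma> *\<^sub>v x = A *\<^sub>v v} = {y}"
    using sol carr(2) by blast
  then show ?thesis
    unfolding x .
qed

end

subsection \<open>Optimal faces\<close>

lemma expo_of_fun:
  fixes f :: "nat \<Rightarrow> nat"
  obtains u where "u \<in> expos n" "\<And>j. Poly_Mapping.lookup u j = (if j < n then f j else 0)"
proof
  let ?u = "Abs_poly_mapping (\<lambda>j. if j < n then f j else 0)"
  have lookup: "Poly_Mapping.lookup ?u = (\<lambda>j. if j < n then f j else 0)"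
    by (rule Abs_poly_mapping_inverse) (auto intro: finite_subset[of _ "{..<n}"] split: if_splits)
  show "Poly_Mapping.lookup ?u j = (if j < n then f j else 0)" for j
    by (simp add: lookup)
  show "?u \<in> expos n"
    by (auto simp: expos_def in_keys_iff lookup split: if_splits)
qed

text \<open>The admissibility condition for the monomial 1, stated through integer programs. The
  dual description below identifies these sets as the subsets of cells of the regular subdivision of
  the columns of \<open>A\<close> induced by \<open>c\<close>.\<close>

definition optimal_face :: "int mat \<Rightarrow> real vec \<Rightarrow> nat set \<Rightarrow> bool" where
  "optimal_face A c \<sigma> \<longleftrightarrow> \<sigma> \<subseteq> {..<dim_col A} \<and>
     (\<forall>w. Poly_Mapping.keys w \<subseteq> \<sigma> \<longrightarrow> \<not> suboptimal A c w)"

context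
  fixes A :: "int mat" and c :: "real vec" and d n :: nat
  assumes A: "A \<in> carrier_mat d n" and c: "c \<in> carrier_vec n"
begin

lemma admissible_pair_zero_iff:
  assumes "generic_cost A c"
  shows "admissible_pair n (initial_ideal c (toric_ideal A :: 'k::field mpoly set)) 0 \<sigma> \<longleftrightarrow>
    optimal_face A c \<sigma>"
proof -
  have "(monomial 0 * monomial w :: 'k mpoly) \<in> initial_ideal c (toric_ideal A) \<longleftrightarrow> suboptimal A c w"
    if "\<sigma> \<subseteq> {..<n}" "Poly_Mapping.keys w \<subseteq> \<sigma>" for w
    using monomial_in_initial_ideal_iff[OF A c assms, of w, where 'k = 'k] that
    by (simp add: expos_def)
  then show ?thesis
    using A by (auto simp: admissible_pair_def optimal_face_def expos_def)
qed

text \<open>A larger face \<tau> competes with \<sigma> through the pair with the same monomial 1,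
  whose quotient is 1 as well.\<close>

lemma optimal_face_maximal:
  assumes "generic_cost A c"
    and "standard_pair n (initial_ideal c (toric_ideal A :: 'k::field mpoly set)) 0 \<sigma>"
  shows "optimal_face A c \<sigma>" "\<And>\<tau>. \<sigma> \<subseteq> \<tau> \<Longrightarrow> optimal_face A c \<tau> \<Longrightarrow> \<tau> = \<sigma>"
proof -
  note adm = admissible_pair_zero_iff[OF assms(1), where 'k = 'k]
  show "optimal_face A c \<sigma>"
    using assms(2) unfolding standard_pair_def adm by blast
  fix \<tau> assume \<tau>: "\<sigma> \<subseteq> \<tau>" "optimal_face A c \<tau>"
  have "\<exists>w::expo. 0 = 0 + w \<and> Poly_Mapping.keys w \<union> \<sigma> \<subseteq> \<tau>"
    using \<tau>(1) by (intro exI[of _ 0]) simp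
  with \<tau>(2) assms(2) show "\<tau> = \<sigma>"
    unfolding standard_pair_def adm[symmetric] by blast
qed

text \<open>\<open>v\<close> and \<open>w\<close> are the positive and negative parts of
  \<open>z\<close>. The relation \<open>A z = 0\<close> puts them in one fiber, and \<open>w\<close>
  lives on \<sigma> because \<open>z\<close> is nonnegative elsewhere.\<close>

lemma kernel_vector_split:
  assumes "\<sigma> \<subseteq> {..<n}" and ker: "\<And>i. i < d \<Longrightarrow> (\<Sum>j<n. A $$ (i, j) * z j) = 0"
    and nonneg: "\<And>j. j < n \<Longrightarrow> j \<notin> \<sigma> \<Longrightarrow> 0 \<le> z j"
  obtains w v where "Poly_Mapping.keys w \<subseteq> \<sigma>" "w \<in> expos n" "v \<in> feasible A w"
    "\<And>j. j < n \<Longrightarrow> int (Poly_Mapping.lookup v j) - int (Poly_Mapping.lookup w j) = z j"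
    "\<And>j. Poly_Mapping.lookup v j = (if j < n then nat (z j) else 0)"
    "weight c v - weight c w = (\<Sum>j<n. c $ j * real_of_int (z j))"
proof -
  obtain v where v: "v \<in> expos n" "\<And>j. Poly_Mapping.lookup v j = (if j < n then nat (z j) else 0)"
    by (rule expo_of_fun[of n "\<lambda>j. nat (z j)"]) blast
  obtain w where w: "w \<in> expos n" "\<And>j. Poly_Mapping.lookup w j = (if j < n then nat (- z j) else 0)"
    by (rule expo_of_fun[of n "\<lambda>j. nat (- z j)"]) blast
  have diff: "int (Poly_Mapping.lookup v j) - int (Poly_Mapping.lookup w j) = z j" if "j < n" for j
    using that v(2) w(2) by simp
  have "Poly_Mapping.keys w \<subseteq> \<sigma>"
  proof
    fix j assume "j \<in> Poly_Mapping.keys w"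
    then have "j < n" "\<not> 0 \<le> z j"
      by (auto simp: in_keys_iff w(2) split: if_splits)
    then show "j \<in> \<sigma>"
      using nonneg by blast
  qed
  moreover have "v \<in> feasible A w"
  proof -
    have "(\<Sum>j<n. A $$ (i, j) * int (Poly_Mapping.lookup v j)) =
        (\<Sum>j<n. A $$ (i, j) * int (Poly_Mapping.lookup w j))" if "i < d" for i
    proof -
      have "(\<Sum>j<n. A $$ (i, j) * int (Poly_Mapping.lookup v j)) -
          (\<Sum>j<n. A $$ (i, j) * int (Poly_Mapping.lookup w j)) = (\<Sum>j<n. A $$ (i, j) * z j)"
        unfolding sum_subtractf[symmetric] right_diff_distrib[symmetric] using diff
        by (intro sum.cong) auto
      then show ?thesis
        using ker[OF that] by simp
    qed
    then show ?thesis
      using v(1) by (simp add: feasible_iff[OF A])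
  qed
  moreover have "weight c v - weight c w = (\<Sum>j<n. c $ j * real_of_int (z j))"
  proof -
    have "real (Poly_Mapping.lookup v j) - real (Poly_Mapping.lookup w j) = real_of_int (z j)"
      if "j < n" for j
      unfolding diff[OF that, symmetric] by simp
    then show ?thesis
      unfolding weight_eq_sum[OF c] sum_subtractf[symmetric] right_diff_distrib[symmetric]
      by (intro sum.cong) auto
  qed
  ultimately show ?thesis
    using that[OF _ w(1) _ diff v(2)] by blast
qed

text \<open>The negative part of \<open>z\<close> is optimal, being supported on \<sigma>, and the
  positive part is a competitor in its fiber; the sum is the difference of their weights.\<close>

lemma optimal_face_cost_nonneg:
  assumes \<sigma>: "optimal_face A c \<sigma>" and ker: "\<And>i. i < d \<Longrightarrow> (\<Sum>j<n. A $$ (i, j) * z j) = 0"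
    and nonneg: "\<And>j. j < n \<Longrightarrow> j \<notin> \<sigma> \<Longrightarrow> 0 \<le> z j"
  shows "0 \<le> (\<Sum>j<n. c $ j * real_of_int (z j))"
proof -
  have \<sigma>n: "\<sigma> \<subseteq> {..<n}"
    using \<sigma> A by (simp add: optimal_face_def)
  obtain w v where "Poly_Mapping.keys w \<subseteq> \<sigma>" "v \<in> feasible A w"
    "weight c v - weight c w = (\<Sum>j<n. c $ j * real_of_int (z j))"
    by (rule kernel_vector_split[where z = z, OF \<sigma>n ker nonneg])
  moreover from this have "\<not> weight c v < weight c w"
    using \<sigma> unfolding optimal_face_def suboptimal_def by blast
  ultimately show ?thesis
    by linarith
qed

text \<open>Now both parts of \<open>z\<close> are supported on \<sigma>, hence both are optimal in
  the same fiber and equal by uniqueness of the optimum.\<close>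

lemma optimal_face_kernel:
  assumes gen: "generic_cost A c" and \<sigma>: "optimal_face A c \<sigma>"
    and ker: "\<And>i. i < d \<Longrightarrow> (\<Sum>j\<in>\<sigma>. A $$ (i, j) * z j) = 0" and z: "\<And>j. j \<notin> \<sigma> \<Longrightarrow> z j = 0"
  shows "z j = 0"
proof -
  have \<sigma>n: "\<sigma> \<subseteq> {..<n}"
    using \<sigma> A by (simp add: optimal_face_def)
  have ker': "(\<Sum>j<n. A $$ (i, j) * z j) = 0" if "i < d" for i
    using ker[OF that] z by (simp add: sum_lessThan_subset_diff[OF \<sigma>n])
  obtain w v where wv: "Poly_Mapping.keys w \<subseteq> \<sigma>" "w \<in> expos n" "v \<in> feasible A w"
    "\<And>j. j < n \<Longrightarrow> int (Poly_Mapping.lookup v j) - int (Poly_Mapping.lookup w j) = z j"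
    "\<And>j. Poly_Mapping.lookup v j = (if j < n then nat (z j) else 0)"
    by (rule kernel_vector_split[where z = z, OF \<sigma>n ker']) (use z in auto)
  have "Poly_Mapping.keys v \<subseteq> \<sigma>"
  proof
    fix k assume "k \<in> Poly_Mapping.keys v"
    then have "z k \<noteq> 0"
      by (auto simp: in_keys_iff wv(5) split: if_splits)
    then show "k \<in> \<sigma>"
      using z by blast
  qed
  then have "\<not> suboptimal A c v" "\<not> suboptimal A c w"
    using \<sigma> wv(1) by (auto simp: optimal_face_def)
  moreover have "w \<in> feasible A v"
    using wv(2,3) A by (simp add: feasible_def Let_def)
  ultimately have "v = w"
    using generic_cost_unique[OF gen _ _ wv(3)] wv(2) A
    by (auto simp: suboptimal_def not_less)
  then show ?thesis
    using wv(4)[of j] z[of j] \<sigma>n by (cases "j < n") auto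
qed

section \<open>Dual solutions that are tight on a face\<close>

text \<open>By elimination it suffices that no combination of the inequalities reads
  \<open>0 \<le> s\<close> with \<open>s\<close> negative. Such a combination comes from an integer
  kernel vector that is nonnegative off \<sigma>, and its right-hand side is the cost already known
  to be nonnegative.\<close>

lemma optimal_face_dual_solution:
  assumes \<sigma>: "optimal_face A c \<sigma>"
  shows "\<exists>y. (\<forall>j<n. (\<Sum>i<d. y i * real_of_int (A $$ (i, j))) \<le> c $ j) \<and>
    (\<forall>j\<in>\<sigma>. (\<Sum>i<d. y i * real_of_int (A $$ (i, j))) = c $ j)"
proof -
  have \<sigma>n: "\<sigma> \<subseteq> {..<n}"
    using \<sigma> A by (simp add: optimal_face_def)
  \<comment> \<open>\<open>z\<close> lists the integer multipliers of the columns. They are free in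
    sign on \<sigma>, where \<open>S\<close> contains each inequality together with its reverse.
    Coefficients from \<open>d\<close> on are set to 0, as elimination in \<open>d\<close> variables
    demands.\<close>
  define C where "C a s \<longleftrightarrow> (\<exists>z. (\<forall>j<n. j \<notin> \<sigma> \<longrightarrow> 0 \<le> z j) \<and>
    a = (\<lambda>i. if i < d then \<Sum>j<n. A $$ (i, j) * z j else 0) \<and> s = (\<Sum>j<n. c $ j * real_of_int (z j)))" for a s
  define S where "S = (\<lambda>j. (\<lambda>i. if i < d then A $$ (i, j) else 0, c $ j)) ` {..<n} \<union>
    (\<lambda>j. (\<lambda>i. if i < d then - A $$ (i, j) else 0, - c $ j)) ` \<sigma>"
  have "\<exists>y. \<forall>(a, s)\<in>S. (\<Sum>i<d. y i * real_of_int (a i)) \<le> s"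
  proof (rule fourier_motzkin[of C])
    fix a s a' s' assume "C a s" "C a' s'"
    then obtain z z' where
      "\<forall>j<n. j \<notin> \<sigma> \<longrightarrow> 0 \<le> z j" "a = (\<lambda>i. if i < d then \<Sum>j<n. A $$ (i, j) * z j else 0)"
      "s = (\<Sum>j<n. c $ j * real_of_int (z j))"
      "\<forall>j<n. j \<notin> \<sigma> \<longrightarrow> 0 \<le> z' j" "a' = (\<lambda>i. if i < d then \<Sum>j<n. A $$ (i, j) * z' j else 0)"
      "s' = (\<Sum>j<n. c $ j * real_of_int (z' j))"
      unfolding C_def by blast
    then show "C (\<lambda>i. a i + a' i) (s + s')"
      unfolding C_def
      by (intro exI[of _ "\<lambda>j. z j + z' j"]) (auto simp: distrib_left sum.distrib)
  next
    fix s assume "C (\<lambda>i. 0) s"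
    then obtain z where z: "\<forall>j<n. j \<notin> \<sigma> \<longrightarrow> 0 \<le> z j"
      "(\<lambda>i. 0) = (\<lambda>i. if i < d then \<Sum>j<n. A $$ (i, j) * z j else 0)"
      "s = (\<Sum>j<n. c $ j * real_of_int (z j))"
      unfolding C_def by blast
    have "(\<Sum>j<n. A $$ (i, j) * z j) = 0" if "i < d" for i
      using fun_cong[OF z(2), of i] that by simp
    then show "0 \<le> s"
      unfolding z(3) using z(1) by (intro optimal_face_cost_nonneg[OF \<sigma>]) auto
  next
    show "finite S"
      using \<sigma>n finite_subset by (auto simp: S_def)
  next
    have unit: "(\<Sum>j<n. A $$ (i, j) * (if j = k then x else 0)) = A $$ (i, k) * x"
      "(\<Sum>j<n. c $ j * real_of_int (if j = k then x else 0)) = c $ k * real_of_int x"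
      if "k < n" for i k x
      using that by (simp_all add: if_distrib[of "(*) _"] if_distrib[of real_of_int] cong: if_cong)
    fix a s assume "(a, s) \<in> S"
    then consider k where "k < n" "a = (\<lambda>i. if i < d then A $$ (i, k) else 0)" "s = c $ k"
      | k where "k \<in> \<sigma>" "k < n" "a = (\<lambda>i. if i < d then - A $$ (i, k) else 0)" "s = - c $ k"
      using \<sigma>n by (auto simp: S_def)
    then show "C a s"
    proof cases
      case 1
      then show ?thesis
        unfolding C_def
        by (intro exI[of _ "\<lambda>j. if j = k then 1 else 0"]) (auto simp: unit)
    next
      case 2
      then show ?thesis
        unfolding C_def
        by (intro exI[of _ "\<lambda>j. if j = k then - 1 else 0"]) (auto simp: unit)
    qed
  next
    fix a s i assume "(a, s) \<in> S" "d \<le> i"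
    then show "a i = 0"
      by (auto simp: S_def)
  qed
  then obtain y where y: "\<And>a s. (a, s) \<in> S \<Longrightarrow> (\<Sum>i<d. y i * real_of_int (a i)) \<le> s"
    by blast
  have "(\<Sum>i<d. y i * real_of_int (A $$ (i, j))) \<le> c $ j" if "j < n" for j
    using y[of "\<lambda>i. if i < d then A $$ (i, j) else 0" "c $ j"] that by (simp add: S_def)
  moreover have "c $ j \<le> (\<Sum>i<d. y i * real_of_int (A $$ (i, j)))" if "j \<in> \<sigma>" for j
    using y[of "\<lambda>i. if i < d then - A $$ (i, j) else 0" "- c $ j"] that by (simp add: S_def sum_negf)
  ultimately show ?thesis
    using \<sigma>n by (intro exI[of _ y]) (auto intro: antisym)
qed

text \<open>Weak duality: \<open>y A\<close> and \<open>c\<close> give the same weight to exponents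
  on \<tau>, \<open>y A\<close> is constant on each fiber, and it never exceeds
  \<open>c\<close>.\<close>

lemma dual_solution_optimal_face:
  assumes \<tau>: "\<tau> \<subseteq> {..<n}"
    and y: "\<And>j. j < n \<Longrightarrow> (\<Sum>i<d. y i * real_of_int (A $$ (i, j))) \<le> c $ j"
    and tight: "\<And>j. j \<in> \<tau> \<Longrightarrow> (\<Sum>i<d. y i * real_of_int (A $$ (i, j))) = c $ j"
  shows "optimal_face A c \<tau>"
proof -
  define r where "r j = (\<Sum>i<d. y i * real_of_int (A $$ (i, j)))" for j
  have r_sum: "(\<Sum>j<n. r j * real (Poly_Mapping.lookup u j)) =
      (\<Sum>i<d. y i * real_of_int (\<Sum>j<n. A $$ (i, j) * int (Poly_Mapping.lookup u j)))" for u
    unfolding r_def sum_distrib_right of_int_sum sum_distrib_left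
    by (subst sum.swap) (simp add: mult_ac)
  have "weight c w \<le> weight c v" if w: "Poly_Mapping.keys w \<subseteq> \<tau>" and v: "v \<in> feasible A w" for w v
  proof -
    have "weight c w = (\<Sum>j<n. r j * real (Poly_Mapping.lookup w j))"
      unfolding weight_eq_sum[OF c]
    proof (rule sum.cong)
      fix j
      show "c $ j * real (Poly_Mapping.lookup w j) = r j * real (Poly_Mapping.lookup w j)"
        using w tight[of j] by (cases "j \<in> \<tau>") (auto simp: r_def in_keys_iff)
    qed simp
    also have "\<dots> = (\<Sum>j<n. r j * real (Poly_Mapping.lookup v j))"
      unfolding r_sum using v by (simp add: feasible_iff[OF A])
    also have "\<dots> \<le> weight c v"
      unfolding weight_eq_sum[OF c] using y
      by (intro sum_mono mult_right_mono) (auto simp: r_def)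
    finally show ?thesis .
  qed
  then show ?thesis
    using \<tau> A by (auto simp: optimal_face_def suboptimal_def not_less)
qed

text \<open>
  Moving the dual solution along a direction orthogonal to the columns in \<open>\<sigma>\<close> makes another
  inequality tight.
\<close>

lemma optimal_face_extend:
  fixes v :: "nat \<Rightarrow> real"
  assumes \<sigma>: "optimal_face A c \<sigma>"
    and orth: "\<And>j. j \<in> \<sigma> \<Longrightarrow> (\<Sum>i<d. v i * real_of_int (A $$ (i, j))) = 0"
    and pos: "k < n" "0 < (\<Sum>i<d. v i * real_of_int (A $$ (i, k)))"
  shows "\<exists>j<n. j \<notin> \<sigma> \<and> optimal_face A c (insert j \<sigma>)"
proof -
  obtain y where y: "\<And>j. j < n \<Longrightarrow> (\<Sum>i<d. y i * real_of_int (A $$ (i, j))) \<le> c $ j"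
    "\<And>j. j \<in> \<sigma> \<Longrightarrow> (\<Sum>i<d. y i * real_of_int (A $$ (i, j))) = c $ j"
    using optimal_face_dual_solution[OF \<sigma>] by blast
  \<comment> \<open>\<open>g j\<close> is the rate at which the left side of inequality
    \<open>j\<close> grows along \<open>v\<close>, and \<open>h j\<close> is its slack at
    \<open>y\<close>.\<close>
  define g where "g j = (\<Sum>i<d. v i * real_of_int (A $$ (i, j)))" for j
  define h where "h j = c $ j - (\<Sum>i<d. y i * real_of_int (A $$ (i, j)))" for j
  define J where "J = {j. j < n \<and> 0 < g j}"
  have "finite J" "J \<noteq> {}"
    using pos by (auto simp: J_def g_def)
  then have "Min ((\<lambda>j. h j / g j) ` J) \<in> (\<lambda>j. h j / g j) ` J"
    by (intro Min_in) auto
  then obtain j0 where j0: "j0 \<in> J" "Min ((\<lambda>j. h j / g j) ` J) = h j0 / g j0"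
    by auto
  \<comment> \<open>The smallest ratio of slack to growth is the longest step that keeps every
    inequality valid; it makes inequality \<open>j0\<close> tight. Growth is zero on \<sigma>, so
    the equations there persist and \<open>j0\<close> is new.\<close>
  define t where "t = h j0 / g j0"
  have t_le: "t \<le> h j / g j" if "j \<in> J" for j
    unfolding t_def j0(2)[symmetric] using \<open>finite J\<close> that by (intro Min_le) auto
  have "0 \<le> t"
    using j0(1) y(1) by (simp add: t_def J_def h_def)
  have tg: "t * g j \<le> h j" if "j < n" for j
  proof (cases "0 < g j")
    case True
    then show ?thesis
      using t_le[of j] that by (simp add: J_def field_simps)
  next
    case False
    then have "t * g j \<le> 0"
      using \<open>0 \<le> t\<close> by (simp add: mult_nonneg_nonpos)
    also have "0 \<le> h j"
      using y(1)[OF that] by (simp add: h_def)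
    finally show ?thesis .
  qed
  have y': "(\<Sum>i<d. (y i + t * v i) * real_of_int (A $$ (i, j))) = c $ j - h j + t * g j" for j
    by (simp add: h_def g_def distrib_right sum.distrib mult.assoc flip: sum_distrib_left)
  have "optimal_face A c (insert j0 \<sigma>)"
  proof (rule dual_solution_optimal_face)
    show "insert j0 \<sigma> \<subseteq> {..<n}"
      using j0(1) \<sigma> A by (auto simp: optimal_face_def J_def)
    show "(\<Sum>i<d. (y i + t * v i) * real_of_int (A $$ (i, j))) \<le> c $ j" if "j < n" for j
      unfolding y' using tg[OF that] by simp
    show "(\<Sum>i<d. (y i + t * v i) * real_of_int (A $$ (i, j))) = c $ j" if "j \<in> insert j0 \<sigma>" for j
    proof (cases "j = j0")
      case True
      then show ?thesis
        unfolding y' using j0(1) by (simp add: t_def J_def)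
    next
      case False
      then have "g j = 0" "h j = 0"
        using that orth y(2) by (auto simp: g_def h_def)
      then show ?thesis
        unfolding y' by simp
    qed
  qed
  moreover have "j0 \<notin> \<sigma>"
    using orth j0(1) by (auto simp: J_def g_def)
  ultimately show ?thesis
    using j0(1) by (auto simp: J_def)
qed

text \<open>Independence of the columns bounds their number by \<open>d\<close>. With fewer than
  \<open>d\<close> columns, some nonzero vector is orthogonal to all of them; by \<open>rank\<close>
  it is not orthogonal to every column of \<open>A\<close>, so it is a direction that enlarges the
  face.\<close>

lemma maximal_optimal_face_basis:
  assumes gen: "generic_cost A c" and \<sigma>: "optimal_face A c \<sigma>"
    and max: "\<And>\<tau>. \<sigma> \<subseteq> \<tau> \<Longrightarrow> optimal_face A c \<tau> \<Longrightarrow> \<tau> = \<sigma>"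
    and rank: "\<And>v :: nat \<Rightarrow> int. (\<And>j. j < n \<Longrightarrow> (\<Sum>i<d. A $$ (i, j) * v i) = 0) \<Longrightarrow> \<forall>i<d. v i = 0"
  shows "card \<sigma> = d" "det (cols_at A \<sigma>) \<noteq> 0"
proof -
  have \<sigma>n: "\<sigma> \<subseteq> {..<n}"
    using \<sigma> A by (simp add: optimal_face_def)
  then have fin: "finite \<sigma>"
    using finite_subset by blast
  note carr = cols_at_carrier[OF A \<sigma>n]
  have ker: "v = 0\<^sub>v (card \<sigma>)" if v: "v \<in> carrier_vec (card \<sigma>)" "cols_at A \<sigma> *\<^sub>v v = 0\<^sub>v d" for v
  proof -
    obtain z where z: "v = vec (card \<sigma>) (\<lambda>k. z (pick \<sigma> k))" "\<And>j. j \<notin> \<sigma> \<Longrightarrow> z j = 0"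
      by (rule vec_pick_cases[OF v(1) fin]) blast
    have sum0: "vec d (\<lambda>i. \<Sum>j\<in>\<sigma>. A $$ (i, j) * z j) = 0\<^sub>v d"
      using v(2) unfolding z(1) cols_at_mult_vec[OF A \<sigma>n] .
    have "(\<Sum>j\<in>\<sigma>. A $$ (i, j) * z j) = 0" if "i < d" for i
      using arg_cong[OF sum0, of "\<lambda>v. v $ i"] that by simp
    then have "z j = 0" for j
      using optimal_face_kernel[OF gen \<sigma>, of z j] z(2) by blast
    then show ?thesis
      unfolding z(1) by (intro eq_vecI) auto
  qed
  have "card \<sigma> \<le> d"
  proof (rule ccontr)
    assume "\<not> card \<sigma> \<le> d"
    then show False
      using wide_matrix_kernel[OF carr] ker by auto
  qed
  moreover have "\<not> card \<sigma> < d"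
  proof
    assume "card \<sigma> < d"
    then obtain v where v: "v \<in> carrier_vec d" "v \<noteq> 0\<^sub>v d"
      "transpose_mat (cols_at A \<sigma>) *\<^sub>v v = 0\<^sub>v (card \<sigma>)"
      using wide_matrix_kernel[of "transpose_mat (cols_at A \<sigma>)" "card \<sigma>" d] carr by auto
    have orth: "(\<Sum>i<d. A $$ (i, j) * v $ i) = 0" if j: "j \<in> \<sigma>" for j
    proof -
      obtain k where k: "k < card \<sigma>" "j = pick \<sigma> k"
        using ex_pick[OF fin j] by blast
      have "(transpose_mat (cols_at A \<sigma>) *\<^sub>v v) $ k = 0"
        using v(3) k(1) by simp
      then show ?thesis
        unfolding transpose_cols_at_mult_vec[OF A \<sigma>n v(1)] using k by simp
    qed
    have "\<not> (\<forall>i<d. v $ i = 0)"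
      using v(1,2) by (auto intro: eq_vecI)
    then obtain k where k: "k < n" "(\<Sum>i<d. A $$ (i, k) * v $ i) \<noteq> 0"
      using rank[of "\<lambda>i. v $ i"] by blast
    \<comment> \<open>The sign turns the direction so that the left side of inequality
      \<open>k\<close> increases.\<close>
    define s where "s = sgn (\<Sum>i<d. A $$ (i, k) * v $ i)"
    have real_sum: "(\<Sum>i<d. real_of_int (s * v $ i) * real_of_int (A $$ (i, j))) =
        real_of_int (s * (\<Sum>i<d. A $$ (i, j) * v $ i))" for j
      by (simp add: sum_distrib_left mult_ac)
    have "\<exists>j<n. j \<notin> \<sigma> \<and> optimal_face A c (insert j \<sigma>)"
    proof (rule optimal_face_extend[OF \<sigma> _ k(1)])
      show "(\<Sum>i<d. real_of_int (s * v $ i) * real_of_int (A $$ (i, j))) = 0" if "j \<in> \<sigma>" for j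
        unfolding real_sum orth[OF that] by simp
      show "0 < (\<Sum>i<d. real_of_int (s * v $ i) * real_of_int (A $$ (i, k)))"
        unfolding real_sum of_int_0_less_iff using k(2) by (simp add: s_def sgn_if)
    qed
    then show False
      using max by blast
  qed
  ultimately show card: "card \<sigma> = d"
    by simp
  show "det (cols_at A \<sigma>) \<noteq> 0"
    using det_0_iff_vec_prod_zero[of "cols_at A \<sigma>" d] carr ker unfolding card by blast
qed

end

subsection \<open>The primal and dual constraint matrices\<close>

lemma primal_mat_carrier: "M \<in> carrier_mat d e \<Longrightarrow> primal_mat M \<in> carrier_mat d (e + d)"
  by (auto simp: primal_mat_def hcat_def)

lemma dual_mat_carrier: "M \<in> carrier_mat d e \<Longrightarrow> dual_mat M \<in> carrier_mat e (e + d)"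
  by (auto simp: dual_mat_def hcat_def)

lemma primal_mat_index:
  assumes "M \<in> carrier_mat d e" "i < d" "j < e + d"
  shows "primal_mat M $$ (i, j) = (if j < e then M $$ (i, j) else if j = e + i then 1 else 0)"
  using assms by (auto simp: primal_mat_def hcat_def)

lemma dual_mat_index:
  assumes "M \<in> carrier_mat d e" "k < e" "j < e + d"
  shows "dual_mat M $$ (k, j) = (if j < e then (if j = k then 1 else 0) else - M $$ (j - e, k))"
  using assms by (auto simp: dual_mat_def hcat_def)

lemma sum_lessThan_add:
  "(\<Sum>j<m + n. f j) = (\<Sum>j<m. f j) + (\<Sum>j<n::nat. f (m + j) :: 'a::comm_monoid_add)"
  by (induction n) (simp_all add: add.assoc)

text \<open>Only two terms survive: column \<open>k\<close> contributes the entry of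
  \<open>M\<close> at \<open>(i, k)\<close>, and column \<open>e + i\<close> contributes its
  negative.\<close>

lemma primal_dual_orthogonal:
  assumes "M \<in> carrier_mat d e" "i < d" "k < e"
  shows "(\<Sum>j<e + d. primal_mat M $$ (i, j) * dual_mat M $$ (k, j)) = 0"
proof -
  have "(\<Sum>j<e. primal_mat M $$ (i, j) * dual_mat M $$ (k, j)) = (\<Sum>j<e. if j = k then M $$ (i, j) else 0)"
    using assms by (intro sum.cong) (auto simp: primal_mat_index dual_mat_index)
  moreover have "(\<Sum>j<d. primal_mat M $$ (i, e + j) * dual_mat M $$ (k, e + j)) =
      (\<Sum>j<d. if j = i then - M $$ (j, k) else 0)"
    using assms by (intro sum.cong) (auto simp: primal_mat_index dual_mat_index)
  ultimately show ?thesis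
    using assms(2,3) by (simp add: sum_lessThan_add)
qed

text \<open>The identity block alone suffices: its column \<open>e + k\<close> reads off
  \<open>v k\<close>.\<close>

lemma primal_mat_rank:
  assumes "M \<in> carrier_mat d e" "\<And>j. j < e + d \<Longrightarrow> (\<Sum>i<d. primal_mat M $$ (i, j) * v i) = 0"
  shows "\<forall>i<d. v i = 0"
proof (intro allI impI)
  fix k assume k: "k < d"
  have "(\<Sum>i<d. primal_mat M $$ (i, e + k) * v i) = (\<Sum>i<d. if i = k then v i else 0)"
    using assms(1) k by (intro sum.cong) (auto simp: primal_mat_index)
  then show "v k = 0"
    using assms(2)[of "e + k"] k by simp
qed

lemma dual_mat_rank:
  assumes "M \<in> carrier_mat d e"
    and "\<And>j. j < e + d \<Longrightarrow> (\<Sum>i<e. real_of_int (dual_mat M $$ (i, j)) * v i) = 0"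
  shows "\<forall>i<e. v i = 0"
proof (intro allI impI)
  fix k assume k: "k < e"
  have "(\<Sum>i<e. real_of_int (dual_mat M $$ (i, k)) * v i) = (\<Sum>i<e. if i = k then v i else 0)"
    using assms(1) k by (intro sum.cong) (auto simp: dual_mat_index)
  then show "v k = 0"
    using assms(2)[of k] k by simp
qed

lemma subvec_interval:
  assumes "v \<in> carrier_vec n" "m \<le> n"
  shows "subvec v {m..<n} = vec (n - m) (\<lambda>k. v $ (m + k))"
    "subvec v {..<m} = vec m (\<lambda>k. v $ k)"
proof -
  have "{m..<n} \<subseteq> {..<n}"
    by auto
  then show "subvec v {m..<n} = vec (n - m) (\<lambda>k. v $ (m + k))"
    using subvec_eq[OF assms(1), of "{m..<n}"] pick_atLeastLessThan[of _ n m]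
    by (intro eq_vecI) auto
  have "{0..<m} \<subseteq> {..<n}"
    using assms(2) by auto
  then show "subvec v {..<m} = vec m (\<lambda>k. v $ k)"
    using subvec_eq[OF assms(1), of "{0..<m}"] pick_atLeastLessThan[of _ m 0]
    unfolding lessThan_atLeast0 by (intro eq_vecI) auto
qed

text \<open>As \<open>b\<close> vanishes on the columns of \<open>M\<close>, only the identity block
  acts. This writes the right-hand side of the system as \<open>A b\<close>, the form needed for
  passing to the complementary basis.\<close>

lemma primal_mat_mult_vec:
  assumes M: "M \<in> carrier_mat d (n - d)" and "d \<le> n" and b: "b \<in> carrier_vec n"
    and b_N: "subvec b {..<n - d} = 0\<^sub>v (n - d)"
  shows "map_mat real_of_int (primal_mat M) *\<^sub>v map_vec real_of_int b =
    map_vec real_of_int (subvec b {n - d..<n})"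
proof -
  have n: "n - d + d = n"
    using \<open>d \<le> n\<close> by simp
  note A = primal_mat_carrier[OF M, unfolded n]
  have zero: "b $ j = 0" if "j < n - d" for j
    using arg_cong[OF b_N, of "\<lambda>v. v $ j"] that subvec_interval(2)[OF b, of "n - d"] by simp
  have "(\<Sum>j<n. primal_mat M $$ (i, j) * b $ j) = b $ (n - d + i)" if "i < d" for i
  proof -
    have "(\<Sum>j<n. primal_mat M $$ (i, j) * b $ j) = (\<Sum>j<n. if j = n - d + i then b $ j else 0)"
      using that n zero by (intro sum.cong) (auto simp: primal_mat_index[OF M that])
    then show ?thesis
      using that n by simp
  qed
  then have "primal_mat M *\<^sub>v b = subvec b {n - d..<n}"
    using A b subvec_interval(1)[OF b, of "n - d"] \<open>d \<le> n\<close>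
    by (intro eq_vecI) (auto simp: scalar_prod_def lessThan_atLeast0)
  then show ?thesis
    by (simp add: of_int_hom.mult_mat_vec_hom[OF A b, symmetric])
qed

lemma dual_program_cost:
  assumes "M \<in> carrier_mat d (n - d)" "d \<le> n" "b \<in> carrier_vec n"
    and "subvec b {..<n - d} = 0\<^sub>v (n - d)"
  shows "lp_cost (dual_program M (subvec b {n - d..<n}) r) = map_vec real_of_int b"
proof -
  have zero: "b $ j = 0" if "j < n - d" for j
    using arg_cong[OF assms(4), of "\<lambda>v. v $ j"] that subvec_interval(2)[OF assms(3), of "n - d"]
    by simp
  then show ?thesis
    using assms subvec_interval(1)[OF assms(3), of "n - d"]
    by (intro eq_vecI) (auto simp: dual_program_def)
qed

section \<open>Solution of the system on a standard pair as a reduced cost\<close>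

theorem theorem3p4:
  fixes d n :: nat
    and M :: "int mat"
    and c :: "real vec"
    and b :: "int vec"
    and r :: "real vec"
    and \<sigma> :: "nat set"
  defines "A \<equiv> primal_mat M"
    and "H \<equiv> map_mat real_of_int (dual_mat M)"
    and "bsig \<equiv> {..<n} - \<sigma>"
    and "b\<^sub>B \<equiv> subvec b {n - d..<n}"
  assumes "d \<le> n"
    and "M \<in> carrier_mat d (n - d)"
    and "unimodular A"
    and "c \<in> carrier_vec n"
    and "generic_cost A c"
    and "b \<in> carrier_vec n"
    and "subvec b {..<n - d} = 0\<^sub>v (n - d)"
    and "r \<in> carrier_vec (n - d)"
    and "standard_pair n (initial_ideal c (toric_ideal A :: 'k::field mpoly set)) 0 \<sigma>"
  shows "lp_basis (dual_program M b\<^sub>B r) bsig \<and>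
    {x \<in> carrier_vec (card \<sigma>). cols_at (map_mat real_of_int A) \<sigma> *\<^sub>v x = map_vec real_of_int b\<^sub>B}
      = {reduced_costs (dual_program M b\<^sub>B r) bsig} \<and>
    reduced_costs (dual_program M b\<^sub>B r) bsig =
      subvec (map_vec real_of_int b) \<sigma> -
      transpose_mat (cols_at H \<sigma>) *\<^sub>v
        (transpose_mat (the (mat_inverse (cols_at H bsig))) *\<^sub>v subvec (map_vec real_of_int b) bsig)"
proof -
  have n: "n - d + d = n"
    using \<open>d \<le> n\<close> by simp
  note M = \<open>M \<in> carrier_mat d (n - d)\<close> and c = \<open>c \<in> carrier_vec n\<close>
    and gen = \<open>generic_cost A c\<close> and b = \<open>b \<in> carrier_vec n\<close>
    and b_N = \<open>subvec b {..<n - d} = 0\<^sub>v (n - d)\<close>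
  have A: "A \<in> carrier_mat d n"
    unfolding A_def using primal_mat_carrier[OF M] n by simp
  have H: "H \<in> carrier_mat (n - d) n"
    unfolding H_def using dual_mat_carrier[OF M] n by simp
  note max = optimal_face_maximal[OF A c gen \<open>standard_pair n _ 0 \<sigma>\<close>]
  have rank: "\<forall>i<d. v i = 0" if "\<And>j. j < n \<Longrightarrow> (\<Sum>i<d. A $$ (i, j) * v i) = 0" for v :: "nat \<Rightarrow> int"
    using primal_mat_rank[OF M, of v] that n by (simp add: A_def)
  have basis: "card \<sigma> = d" "det (cols_at A \<sigma>) \<noteq> 0"
    using maximal_optimal_face_basis[OF A c gen max rank] by simp_all
  have \<sigma>: "\<sigma> \<subseteq> {..<n}"
    using max(1) A by (simp add: optimal_face_def)
  let ?A = "map_mat real_of_int A"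
  have rA: "?A \<in> carrier_mat d n"
    using A by simp
  \<comment> \<open>The integer determinant is carried over to the reals, where the inverse of the
    complementary submatrix of \<open>H\<close> exists.\<close>
  have det_A: "det (cols_at ?A \<sigma>) \<noteq> 0"
    using basis(2) by (simp flip: map_mat_cols_at[OF A \<sigma>])
  have orth: "(\<Sum>j<n. ?A $$ (i, j) * H $$ (k, j)) = 0" if "i < d" "k < n - d" for i k
  proof -
    have "(\<Sum>j<n. ?A $$ (i, j) * H $$ (k, j)) =
        real_of_int (\<Sum>j<n. A $$ (i, j) * dual_mat M $$ (k, j))"
      unfolding of_int_sum using that A H by (intro sum.cong) (auto simp: H_def)
    also have "\<dots> = 0"
      unfolding A_def using primal_dual_orthogonal[OF M that, unfolded n] by (simp only: of_int_0)
    finally show ?thesis .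
  qed
  have inj: "\<forall>k<n - d. u k = 0" if u: "\<And>j. j < n \<Longrightarrow> (\<Sum>k<n - d. H $$ (k, j) * u k) = 0" for u
  proof (rule dual_mat_rank[OF M])
    fix j assume "j < n - d + d"
    then have "j < n"
      using n by simp
    then show "(\<Sum>k<n - d. real_of_int (dual_mat M $$ (k, j)) * u k) = 0"
      using u[of j] H by (simp add: H_def)
  qed
  note context_facts = rA H \<open>d \<le> n\<close> \<sigma> basis(1) orth det_A
  have det_H: "det (cols_at H bsig) \<noteq> 0"
    unfolding bsig_def by (rule det_complement_nonzero[OF context_facts inj])
  have lp: "lp_mat (dual_program M b\<^sub>B r) = H"
    by (simp add: dual_program_def H_def)
  have "{..<n} - bsig = \<sigma>"
    using \<sigma> by (auto simp: bsig_def)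
  \<comment> \<open>The nonbasic variables for \<open>bsig\<close> are exactly those in \<sigma>,
    and the cost vector of the dual program is \<open>b\<close> itself because \<open>b\<close>
    starts with \<open>n - d\<close> zeros.\<close>
  then have reduced: "reduced_costs (dual_program M b\<^sub>B r) bsig =
      subvec (map_vec real_of_int b) \<sigma> -
      transpose_mat (cols_at H \<sigma>) *\<^sub>v
        (transpose_mat (the (mat_inverse (cols_at H bsig))) *\<^sub>v subvec (map_vec real_of_int b) bsig)"
    using dual_program_cost[OF M \<open>d \<le> n\<close> b b_N, folded b\<^sub>B_def] H
    by (simp add: reduced_costs_def Let_def lp)
  have "lp_basis (dual_program M b\<^sub>B r) bsig"
    unfolding lp_basis_def lp
    using det_nonzero_invertible_mat[OF complement_carrier[OF context_facts]] det_H H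
    by (auto simp: bsig_def)
  moreover have "{x \<in> carrier_vec (card \<sigma>). cols_at ?A \<sigma> *\<^sub>v x = map_vec real_of_int b\<^sub>B} =
      {reduced_costs (dual_program M b\<^sub>B r) bsig}"
    unfolding reduced basis(1) primal_mat_mult_vec[OF M \<open>d \<le> n\<close> b b_N, folded A_def b\<^sub>B_def, symmetric]
    using system_solution_complement[OF context_facts _ det_H[unfolded bsig_def],
        of "map_vec real_of_int b", folded bsig_def] b
    by simp
  ultimately show ?thesis
    using reduced by blast
qed

end
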